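(* Let $d\ge 2$ be an integer and let $q$ be a prime power. There exist infinitely many compact $[A]$-orbits $[A]\mathfrak{x}$, $\mathfrak{x}\in[\mathcal{L}_d]$, such that $\mu(\mathfrak{x})=q^{-d}$.
   Context: Let $\mathcal{R}=\mathbb{F}_q[x]$, $\mathcal{K}=\mathbb{F}_q(x)$, with absolute value $|f/g|=q^{\deg f-\deg g}$, and let $\tilde{\mathcal{K}}=\mathbb{F}_q((x^{-1}))$ be the completion. Let $G=\operatorname{GL}_d(\tilde{\mathcal{K}})$, $\Gamma=\operatorname{GL}_d(\mathcal{R})$, $[G]=\operatorname{PGL}_d(\tilde{\mathcal{K}})=G/\tilde{\mathcal{K}}^*I$, and let $[\Gamma]$ be the image of $\Gamma$ in $[G]$. The space $[\mathcal{L}_d]=[G]/[\Gamma]$ (quotient topology) is identified with the space of lattices $g\mathcal{R}^d\subseteq\tilde{\mathcal{K}}^d$, $g\in G$, up to homothety (multiplication by $\tilde{\mathcal{K}}^*$). $[A]$ is the group of (images in $[G]$ of) invertible diagonal matrices, acting on $[\mathcal{L}_d]$ by left multiplication. For $\mathbf{v}\in\tilde{\mathcal{K}}^d$ let $N(\mathbf{v})=\prod_{i=1}^d|v_i|$. For $\mathfrak{x}\in[\mathcal{L}_d]$ the homothety class of $g\mathcal{R}^d$, define $$\mu(\mathfrak{x})=\frac{1}{|\det(g)|}\sup_{\mathbf{v}\in\tilde{\mathcal{K}}^d}\ \inf_{\mathbf{u}\in g\mathcal{R}^d}N(\mathbf{v}-\mathbf{u}),$$ which does not depend on the choice of representative $g\mathcal{R}^d$.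 *)

theory Defs
  imports "HOL-Analysis.Analysis" "HOL-Computational_Algebra.Formal_Laurent_Series"
begin

no_notation fps_nth (infixl "$" 75)

text \<open>The finite field is a type \<open>'k\<close> of sort \<open>{finite, field}\<close> with \<open>q = CARD('k)\<close> elements, and
  the completion \<open>F\<^sub>q((1/x))\<close> is \<open>'k fls\<close>, where the formal variable \<open>fls_X\<close> stands for \<open>1/x\<close> and
  hence \<open>fls_X_inv\<close> for \<open>x\<close>.  The library metric on \<open>'k fls\<close> has base 2 instead of \<open>q\<close>;
  it induces the topology of the absolute value below.  Matrices carry the product topology.\<close>

definition poly_ring :: "'k::field fls set" where
  "poly_ring = range (\<lambda>p. poly (map_poly fls_const p) fls_X_inv)"

text \<open>\<open>fls_subdegree f\<close> is the least exponent of \<open>1/x\<close> in \<open>f\<close>, that is, minus the degree in \<open>x\<close>.\<close>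

definition absv :: "'k::{finite,field} fls \<Rightarrow> real" where
  "absv f = (if f = 0 then 0 else real CARD('k) powi (- fls_subdegree f))"

definition Nprod :: "'k::{finite,field} fls ^ 'd \<Rightarrow> real" where
  "Nprod v = (\<Prod>i\<in>UNIV. absv (v $ i))"


definition quotient_topology :: "'a topology \<Rightarrow> ('a \<Rightarrow> 'b) \<Rightarrow> 'b topology" where
  "quotient_topology X f =
     topology (\<lambda>U. U \<subseteq> f ` topspace X \<and> openin X {x \<in> topspace X. f x \<in> U})"

lemma openin_quotient_topology:
  "openin (quotient_topology X f) U \<longleftrightarrow>
     U \<subseteq> f ` topspace X \<and> openin X {x \<in> topspace X. f x \<in> U}"
proof -
  have "istopology (\<lambda>U. U \<subseteq> f ` topspace X \<and> openin X {x \<in> topspace X. f x \<in> U})"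
    unfolding istopology_def
  proof (intro conjI allI impI)
    fix S T
    assume S: "S \<subseteq> f ` topspace X \<and> openin X {x \<in> topspace X. f x \<in> S}"
      and T: "T \<subseteq> f ` topspace X \<and> openin X {x \<in> topspace X. f x \<in> T}"
    show "S \<inter> T \<subseteq> f ` topspace X" using S by blast
    have "{x \<in> topspace X. f x \<in> S \<inter> T} =
      {x \<in> topspace X. f x \<in> S} \<inter> {x \<in> topspace X. f x \<in> T}" by blast
    then show "openin X {x \<in> topspace X. f x \<in> S \<inter> T}"
      using S T by (simp add: openin_Int)
  next
    fix \<K>
    assume K: "\<forall>S\<in>\<K>. S \<subseteq> f ` topspace X \<and> openin X {x \<in> topspace X. f x \<in> S}"
    show "\<Union>\<K> \<subseteq> f ` topspace X" using K by blast
    have "{x \<in> topspace X. f x \<in> \<Union>\<K>} = (\<Union>S\<in>\<K>. {x \<in> topspace X. f x \<in> S})" by blast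
    then show "openin X {x \<in> topspace X. f x \<in> \<Union>\<K>}"
      using K by (metis (no_types, lifting) openin_Union image_iff)
  qed
  then show ?thesis by (simp add: quotient_topology_def topology_inverse')
qed

lemma topspace_quotient_topology [simp]:
  "topspace (quotient_topology X f) = f ` topspace X"
proof
  show "topspace (quotient_topology X f) \<subseteq> f ` topspace X"
    by (metis openin_quotient_topology openin_topspace)
  have "{x \<in> topspace X. f x \<in> f ` topspace X} = topspace X" by blast
  then have "openin (quotient_topology X f) (f ` topspace X)"
    by (simp add: openin_quotient_topology)
  then show "f ` topspace X \<subseteq> topspace (quotient_topology X f)"
    by (rule openin_subset)
qed

lemma quotient_map_quotient_topology:
  "quotient_map X (quotient_topology X f) f"
  by (auto simp: quotient_map_def openin_quotient_topology)


definition GL :: "('k::field fls ^ 'd ^ 'd) set" where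
  "GL = {g. invertible g}"

definition GL_poly :: "('k::field fls ^ 'd ^ 'd) set" where
  "GL_poly = {g. (\<forall>i j. g $ i $ j \<in> poly_ring) \<and>
     (\<exists>h. (\<forall>i j. h $ i $ j \<in> poly_ring) \<and> g ** h = mat 1 \<and> h ** g = mat 1)}"

text \<open>The image of \<open>g\<close> in the projective group, as a coset of the scalar matrices.\<close>

definition pgl_proj :: "'k::field fls ^ 'd ^ 'd \<Rightarrow> ('k fls ^ 'd ^ 'd) set" where
  "pgl_proj g = {mat c ** g | c. c \<noteq> 0}"

definition PGL_topology :: "('k::field fls ^ 'd ^ 'd) set topology" where
  "PGL_topology = quotient_topology (subtopology euclidean GL) pgl_proj"

definition diag_group :: "('k::field fls ^ 'd ^ 'd) set set" where
  "diag_group = pgl_proj ` {a \<in> GL. \<forall>i j. i \<noteq> j \<longrightarrow> a $ i $ j = 0}"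


definition lattice_of :: "'k::field fls ^ 'd ^ 'd \<Rightarrow> ('k fls ^ 'd) set" where
  "lattice_of g = (\<lambda>u. g *v u) ` {u. \<forall>i. u $ i \<in> poly_ring}"

text \<open>The homothety class of the lattice of \<open>g\<close> is \<open>lattice_of ` pgl_proj g\<close>.  The lemma
  \<open>lattice_class_eq_iff\<close> below shows that the fibres of this map on the projective group
  are the cosets of the image of \<open>GL_poly\<close>, so that \<open>lattice_space\<close> is the quotient by that subgroup.\<close>

definition lattice_space :: "('k::field fls ^ 'd) set set topology" where
  "lattice_space = quotient_topology PGL_topology (image lattice_of)"

definition act :: "('k::field fls ^ 'd ^ 'd) set \<Rightarrow> ('k fls ^ 'd) set set \<Rightarrow> ('k fls ^ 'd) set set" where
  "act \<gamma> x = {(\<lambda>v. a *v v) ` L | a L. a \<in> \<gamma> \<and> L \<in> x}"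

definition diag_orbit :: "('k::field fls ^ 'd) set set \<Rightarrow> ('k fls ^ 'd) set set set" where
  "diag_orbit x = (\<lambda>a. act a x) ` diag_group"

text \<open>The choice of \<open>g\<close> is immaterial.  The infimum is over a nonempty set of nonnegative reals, and
  the supremum is finite because every vector is congruent modulo the lattice to one
  in a fixed bounded set.\<close>

definition mu :: "('k::{finite,field} fls ^ 'd) set set \<Rightarrow> real" where
  "mu x = (let g = (SOME g. g \<in> GL \<and> x = lattice_of ` pgl_proj g)
           in 1 / absv (det g) * (SUP v. INF u\<in>lattice_of g. Nprod (v - u)))"


lemma poly_ring_0: "0 \<in> poly_ring"
  unfolding poly_ring_def by (rule image_eqI[of _ _ 0]) auto

lemma poly_ring_1: "1 \<in> poly_ring"
  unfolding poly_ring_def by (rule image_eqI[of _ _ 1]) (auto simp: map_poly_1)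

lemma poly_ring_add:
  assumes "a \<in> poly_ring" "b \<in> poly_ring"
  shows "a + b \<in> poly_ring"
proof -
  obtain p r where p: "a = poly (map_poly fls_const p) fls_X_inv"
    and r: "b = poly (map_poly fls_const r) fls_X_inv"
    using assms unfolding poly_ring_def by blast
  have "map_poly fls_const (p + r) = map_poly fls_const p + map_poly fls_const r"
    by (intro poly_eqI) (simp add: coeff_map_poly fls_plus_const)
  then have "a + b = poly (map_poly fls_const (p + r)) fls_X_inv"
    by (simp add: p r)
  then show ?thesis unfolding poly_ring_def by blast
qed

lemma poly_ring_mult:
  assumes "a \<in> poly_ring" "b \<in> poly_ring"
  shows "a * b \<in> poly_ring"
proof -
  obtain p r where p: "a = poly (map_poly fls_const p) fls_X_inv"
    and r: "b = poly (map_poly fls_const r) fls_X_inv"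
    using assms unfolding poly_ring_def by blast
  have s: "fls_const (sum f A) = (\<Sum>i\<in>A. fls_const (f i))" if "finite A"
    for f :: "nat \<Rightarrow> 'a" and A
    using that by (induction A rule: finite_induct) (simp_all flip: fls_plus_const)
  have "map_poly fls_const (p * r) = map_poly fls_const p * map_poly fls_const r"
    by (intro poly_eqI) (simp add: coeff_map_poly coeff_mult s fls_const_mult_const)
  then have "a * b = poly (map_poly fls_const (p * r)) fls_X_inv"
    by (simp add: p r)
  then show ?thesis unfolding poly_ring_def by blast
qed

lemma poly_ring_sum:
  assumes "\<And>i. i \<in> A \<Longrightarrow> f i \<in> poly_ring"
  shows "sum f A \<in> poly_ring"
  using assms by (induction A rule: infinite_finite_induct) (auto intro: poly_ring_0 poly_ring_add)

lemma lattice_mult_GL_poly: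
  fixes g \<gamma> :: "'k::field fls ^ 'd ^ 'd"
  assumes "\<gamma> \<in> GL_poly"
  shows "lattice_of (g ** \<gamma>) = lattice_of g"
proof -
  obtain h where \<gamma>: "\<forall>i j. \<gamma> $ i $ j \<in> poly_ring" and h: "\<forall>i j. h $ i $ j \<in> poly_ring"
    and gh: "\<gamma> ** h = mat 1"
    using assms unfolding GL_poly_def by blast
  have stable: "\<forall>i. (m *v u) $ i \<in> poly_ring"
    if "\<forall>i j. m $ i $ j \<in> poly_ring" "\<forall>i. u $ i \<in> poly_ring"
    for m :: "'k fls ^ 'd ^ 'd" and u
    using that by (auto simp: matrix_vector_mult_def intro!: poly_ring_sum poly_ring_mult)
  show ?thesis
  proof
    show "lattice_of (g ** \<gamma>) \<subseteq> lattice_of g"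
      unfolding lattice_of_def using stable[OF \<gamma>]
      by (auto simp flip: matrix_vector_mul_assoc)
    show "lattice_of g \<subseteq> lattice_of (g ** \<gamma>)"
    proof
      fix w assume "w \<in> lattice_of g"
      then obtain u where u: "\<forall>i. u $ i \<in> poly_ring" and w: "w = g *v u"
        unfolding lattice_of_def by blast
      have "w = (g ** \<gamma>) *v (h *v u)"
        by (metis w gh matrix_mul_assoc matrix_mul_rid matrix_vector_mul_assoc)
      then show "w \<in> lattice_of (g ** \<gamma>)"
        unfolding lattice_of_def using stable[OF h u] by blast
    qed
  qed
qed

lemma lattice_eqD:
  fixes g h :: "'k::field fls ^ 'd ^ 'd"
  assumes g: "invertible g" and h: "invertible h" and eq: "lattice_of g = lattice_of h"
  shows "\<exists>\<gamma>\<in>GL_poly. h = g ** \<gamma>"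
proof -
  have transition: "\<forall>i j. (gi ** h) $ i $ j \<in> poly_ring"
    if gi: "gi ** g = mat 1" and eq: "lattice_of g = lattice_of h"
    for g gi h :: "'k fls ^ 'd ^ 'd"
  proof (intro allI)
    fix i j
    have "h *v axis j 1 \<in> lattice_of h"
      unfolding lattice_of_def
      by (intro image_eqI[OF refl]) (auto simp: axis_def poly_ring_0 poly_ring_1)
    then obtain u where u: "\<forall>i. u $ i \<in> poly_ring" and "h *v axis j 1 = g *v u"
      using eq unfolding lattice_of_def by blast
    then have "(gi ** h) *v axis j 1 = u"
      by (metis gi matrix_vector_mul_assoc matrix_vector_mul_lid)
    moreover have "(M *v axis j 1) $ i = M $ i $ j" for M :: "'k fls ^ 'd ^ 'd"
      by (simp add: matrix_vector_mult_def axis_def if_distrib mult_delta_right cong: if_cong)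
    ultimately show "(gi ** h) $ i $ j \<in> poly_ring"
      using u by metis
  qed
  obtain gi where gi: "g ** gi = mat 1" "gi ** g = mat 1"
    using g unfolding invertible_def by blast
  obtain hi where hi: "h ** hi = mat 1" "hi ** h = mat 1"
    using h unfolding invertible_def by blast
  have "(gi ** h) ** (hi ** g) = mat 1" "(hi ** g) ** (gi ** h) = mat 1"
    by (metis gi hi matrix_mul_assoc matrix_mul_rid)+
  then have "gi ** h \<in> GL_poly"
    unfolding GL_poly_def
    using transition[OF gi(2) eq] transition[OF hi(2) eq[symmetric]] by blast
  moreover have "h = g ** (gi ** h)"
    by (metis gi(1) matrix_mul_assoc matrix_mul_lid)
  ultimately show ?thesis by blast
qed

lemma mat_mult_mat: "mat a ** mat b = (mat (a * b) :: 'k::field fls ^ 'd ^ 'd)"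
  by (simp add: matrix_matrix_mult_def mat_def vec_eq_iff mult_delta_left)

lemma pgl_proj_scale:
  fixes g :: "'k::field fls ^ 'd ^ 'd"
  assumes "c \<noteq> 0"
  shows "pgl_proj (mat c ** g) = pgl_proj g"
proof
  show "pgl_proj (mat c ** g) \<subseteq> pgl_proj g"
  proof
    fix m assume "m \<in> pgl_proj (mat c ** g)"
    then obtain b where b: "b \<noteq> 0" "m = mat b ** (mat c ** g)" unfolding pgl_proj_def by blast
    then have "m = mat (b * c) ** g" by (simp add: matrix_mul_assoc mat_mult_mat)
    moreover have "b * c \<noteq> 0" using assms b by simp
    ultimately show "m \<in> pgl_proj g" unfolding pgl_proj_def by blast
  qed
  show "pgl_proj g \<subseteq> pgl_proj (mat c ** g)"
  proof
    fix m assume "m \<in> pgl_proj g"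
    then obtain b where b: "b \<noteq> 0" "m = mat b ** g" unfolding pgl_proj_def by blast
    then have "m = mat (b / c) ** (mat c ** g)"
      using assms by (simp add: matrix_mul_assoc mat_mult_mat)
    moreover have "b / c \<noteq> 0" using assms b by simp
    ultimately show "m \<in> pgl_proj (mat c ** g)" unfolding pgl_proj_def by blast
  qed
qed

lemma lattice_class_eq_iff:
  fixes g h :: "'k::field fls ^ 'd ^ 'd"
  assumes "g \<in> GL" "h \<in> GL"
  shows "lattice_of ` pgl_proj g = lattice_of ` pgl_proj h \<longleftrightarrow>
    (\<exists>\<gamma>\<in>GL_poly. pgl_proj h = pgl_proj (g ** \<gamma>))"
proof
  assume eq: "lattice_of ` pgl_proj g = lattice_of ` pgl_proj h"
  have "h = mat 1 ** h" by simp
  then have "h \<in> pgl_proj h" unfolding pgl_proj_def using one_neq_zero by blast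
  then have "lattice_of h \<in> lattice_of ` pgl_proj g" unfolding eq by (rule imageI)
  then obtain c where c: "c \<noteq> 0" "lattice_of (mat c ** g) = lattice_of h"
    unfolding pgl_proj_def by blast
  have "mat c ** mat (1 / c) = (mat 1 :: 'k fls ^ 'd ^ 'd)"
       "mat (1 / c) ** mat c = (mat 1 :: 'k fls ^ 'd ^ 'd)"
    using c(1) by (simp_all add: mat_mult_mat)
  then have "invertible (mat c :: 'k fls ^ 'd ^ 'd)" unfolding invertible_def by blast
  then have "invertible (mat c ** g)" using assms(1) by (simp add: GL_def invertible_mult)
  then obtain \<gamma> where "\<gamma> \<in> GL_poly" "h = mat c ** g ** \<gamma>"
    using lattice_eqD c(2) assms(2) unfolding GL_def by blast
  then show "\<exists>\<gamma>\<in>GL_poly. pgl_proj h = pgl_proj (g ** \<gamma>)"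
    using pgl_proj_scale[OF c(1)] by (metis matrix_mul_assoc)
next
  assume "\<exists>\<gamma>\<in>GL_poly. pgl_proj h = pgl_proj (g ** \<gamma>)"
  then obtain \<gamma> where \<gamma>: "\<gamma> \<in> GL_poly" "pgl_proj h = pgl_proj (g ** \<gamma>)" by blast
  have img: "lattice_of ` pgl_proj m = {lattice_of (mat c ** m) | c. c \<noteq> 0}"
    for m :: "'k fls ^ 'd ^ 'd"
    unfolding pgl_proj_def by blast
  show "lattice_of ` pgl_proj g = lattice_of ` pgl_proj h"
    unfolding \<gamma>(2) img by (simp add: matrix_mul_assoc lattice_mult_GL_poly[OF \<gamma>(1)])
qed

end

(* The lattice is an order O = R[a] of degree d, split at infinity, where a is a root of
   prod_i (T - Q_i) = 1 for distinct multiples Q_i of x.  The conjugates of a are close to the Q_i, and the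
   a - Q_i are units whose logarithm vectors are the rows of the Laplacian of the complete graph with
   weights log|Q_i - Q_j|; let W be the sum of the weights, so that O has covolume q^W.

   Rounding coordinates in the Newton basis prod_(i<k) (a - Q_i) gives mu <= q^(-d).  For the reverse
   inequality let b be the sum of the Newton basis.  The class of b modulo x O is fixed by all the units
   a - Q_i.  If an element of this class had norm less than q^W, then multiplication by a suitable unit
   (chip firing on the graph) would make its j-th conjugate smaller than prod_(i/=j) |Q_i - Q_j| for
   every j, so by Lagrange interpolation its leading coordinate would have absolute value less than 1;
   but that coordinate is congruent to 1 modulo x.  So N(b/x - u) >= q^(W-d) for all u in O.

   The orbit is compact because the units have full rank d - 1.  Orbits are distinguished by the infimum
   of N over the nonzero lattice vectors relative to the covolume: it is positive, and at most q^(-W)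
   because N(1) = 1, while W can be arbitrarily large. *)

theory Submission
  imports Defs
begin

section \<open>The absolute value\<close>

notation fls_nth (infixl "$$" 75)

lemma card_field_ge_2: "real CARD('k::{finite,field}) \<ge> 2"
proof -
  have "card {0, 1 :: 'k} \<le> CARD('k)"
    by (intro card_mono) auto
  then show ?thesis by simp
qed

lemma absv_0 [simp]: "absv 0 = 0"
  by (simp add: absv_def)

lemma absv_nonzero: "f \<noteq> 0 \<Longrightarrow> absv f = real CARD('k) powi (- fls_subdegree f)"
  for f :: "'k::{finite,field} fls"
  by (simp add: absv_def)

lemma absv_nonneg [simp]: "0 \<le> absv f"
  by (simp add: absv_def)

lemma absv_eq_0_iff [simp]: "absv f = 0 \<longleftrightarrow> f = 0"
  by (auto simp: absv_def)

lemma absv_pos_iff [simp]: "0 < absv f \<longleftrightarrow> f \<noteq> 0"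
  by (auto simp: less_le)

lemma absv_1 [simp]: "absv 1 = 1"
  by (simp add: absv_def)

lemma absv_mult: "absv (f * g) = absv f * absv g"
  by (auto simp: absv_def simp flip: power_int_add)

lemma absv_prod: "absv (prod f A) = (\<Prod>i\<in>A. absv (f i))"
  by (induction A rule: infinite_finite_induct) (auto simp: absv_mult)

lemma absv_power: "absv (f ^ n) = absv f ^ n"
  by (induction n) (auto simp: absv_mult)

lemma absv_inverse: "absv (inverse f) = inverse (absv f)"
  by (metis absv_1 absv_eq_0_iff absv_mult inverse_unique inverse_zero right_inverse)

lemma absv_uminus [simp]: "absv (- f) = absv f"
  by (simp add: absv_def)

lemma absv_minus_commute: "absv (f - g) = absv (g - f)"
  using absv_uminus[of "f - g"] by simp

lemma absv_fls_X_inv [simp]: "absv (fls_X_inv :: 'k::{finite,field} fls) = real CARD('k)"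
  by (simp add: absv_def)

lemma powi_le_iff: "1 < a \<Longrightarrow> a powi m \<le> a powi n \<longleftrightarrow> m \<le> n" for a :: real
  by (meson linorder_not_less order_less_imp_le power_int_increasing power_int_strict_increasing)

lemma powi_card_le_iff:
  "real CARD('k::{finite,field}) powi m \<le> real CARD('k) powi n \<longleftrightarrow> m \<le> n"
  using card_field_ge_2[where 'k='k] by (intro powi_le_iff) auto

lemma powi_card_less_iff:
  "real CARD('k::{finite,field}) powi m < real CARD('k) powi n \<longleftrightarrow> m < n"
  using powi_card_le_iff[where 'k='k, of n m] by linarith

lemma absv_le_powi_iff:
  fixes f :: "'k::{finite,field} fls"
  shows "absv f \<le> real CARD('k) powi n \<longleftrightarrow> (\<forall>m < - n. f $$ m = 0)"
proof (cases "f = 0")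
  case False
  then have "(\<forall>m < - n. f $$ m = 0) \<longleftrightarrow> -n \<le> fls_subdegree f"
    by (metis fls_eq0_below_subdegree fls_subdegree_geI less_le_trans)
  then show ?thesis
    using False powi_card_le_iff[where 'k='k] by (auto simp: absv_nonzero)
qed simp

text \<open>The value group is discrete, so a strict bound gains a full factor
  \<open>q\<close>.\<close>

lemma absv_less_powi_iff:
  fixes f :: "'k::{finite,field} fls"
  shows "absv f < real CARD('k) powi n \<longleftrightarrow> absv f \<le> real CARD('k) powi (n - 1)"
proof (cases "f = 0")
  case False
  then show ?thesis
    using powi_card_le_iff[where 'k='k] powi_card_less_iff[where 'k='k]
    by (auto simp: absv_nonzero)
qed (auto simp: zero_less_power_int intro: order.strict_implies_order)

lemma absv_add_le:
  fixes f g :: "'k::{finite,field} fls"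
  assumes "absv f \<le> c" "absv g \<le> c"
  shows "absv (f + g) \<le> c"
proof (cases "f = 0 \<or> g = 0 \<or> f + g = 0")
  case False
  have "min (fls_subdegree f) (fls_subdegree g) \<le> fls_subdegree (f + g)"
    using False by (intro fls_subdegree_geI) auto
  then have "absv (f + g) \<le> absv f \<or> absv (f + g) \<le> absv g"
    using False by (auto simp: absv_nonzero powi_card_le_iff min_def split: if_splits)
  with assms show ?thesis by linarith
next
  case True
  moreover have "0 \<le> c"
    using assms(1) absv_nonneg[of f] by linarith
  ultimately show ?thesis using assms by auto
qed

lemma absv_sum_le:
  assumes "\<And>i. i \<in> A \<Longrightarrow> absv (f i) \<le> c" "0 \<le> c"
  shows "absv (sum f A) \<le> c"
  using assms by (induction A rule: infinite_finite_induct) (auto intro: absv_add_le)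

lemma absv_sum_less:
  assumes "\<And>i. i \<in> A \<Longrightarrow> absv (f i) < c" "0 < c"
  shows "absv (sum f A) < c"
  using assms
proof (induction A rule: infinite_finite_induct)
  case (insert x F)
  then have "absv (f x + sum f F) \<le> max (absv (f x)) (absv (sum f F))"
    by (intro absv_add_le) auto
  also have "\<dots> < c" using insert by auto
  finally show ?case using insert by simp
qed auto

lemma absv_add_eq:
  assumes "absv g < absv f"
  shows "absv (f + g) = absv f"
proof (rule antisym)
  show "absv (f + g) \<le> absv f" using assms by (intro absv_add_le) auto
  have "absv ((f + g) + - g) \<le> max (absv (f + g)) (absv g)"
    by (rule absv_add_le) auto
  then show "absv f \<le> absv (f + g)" using assms by (auto simp: max_def split: if_splits)
qed

text \<open>Exchange the factors one at a time; all the others have absolute value at most 1. This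
  gives the contraction estimate in \<open>ex_small_root\<close>.\<close>

lemma absv_prod_diff_le:
  assumes "\<And>i. i \<in> A \<Longrightarrow> absv (a i) \<le> 1" "\<And>i. i \<in> A \<Longrightarrow> absv (b i) \<le> 1"
    and "\<And>i. i \<in> A \<Longrightarrow> absv (a i - b i) \<le> c" and "0 \<le> c"
  shows "absv (prod a A - prod b A) \<le> c"
  using assms
proof (induction A rule: infinite_finite_induct)
  case (insert x F)
  have "absv (prod b F) \<le> 1"
    unfolding absv_prod using insert by (intro prod_le_1) auto
  have "absv (a x * (prod a F - prod b F)) \<le> 1 * c"
    unfolding absv_mult using insert by (intro mult_mono) auto
  moreover have "absv ((a x - b x) * prod b F) \<le> c * 1"
    unfolding absv_mult using insert \<open>absv (prod b F) \<le> 1\<close> by (intro mult_mono) auto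
  ultimately have "absv (a x * (prod a F - prod b F) + (a x - b x) * prod b F) \<le> c"
    by (intro absv_add_le) auto
  then show ?case using insert by (simp add: algebra_simps)
qed auto

text \<open>The terms of the Leibniz expansion other than the diagonal one are strictly smaller.\<close>

lemma absv_det_row_dominant:
  fixes A :: "'k::{finite,field} fls ^ 'd ^ 'd"
  assumes dom: "\<And>i j. i \<noteq> j \<Longrightarrow> absv (A $ i $ j) < absv (A $ i $ i)"
    and nz: "\<And>i. A $ i $ i \<noteq> 0"
  shows "absv (det A) = (\<Prod>i\<in>UNIV. absv (A $ i $ i))"
proof -
  let ?t = "\<lambda>p. of_int (sign p) * (\<Prod>i\<in>UNIV. A $ i $ p i)"
  let ?P = "{p. p permutes (UNIV :: 'd set)}"
  have id: "id \<in> ?P" by (simp add: permutes_id)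
  have abs_sgn: "absv (of_int (sign p) * x) = absv x" for p and x :: "'k fls"
    by (cases rule: sign_cases[of p]) auto
  have small: "absv (?t p) < absv (?t id)" if p: "p \<in> ?P - {id}" for p
  proof -
    obtain i where i: "p i \<noteq> i" using p by (metis DiffE eq_id_iff singletonI)
    have le: "absv (A $ j $ p j) \<le> absv (A $ j $ j)" for j
      using dom[of j "p j"] by (cases "p j = j") auto
    have "(\<Prod>j\<in>UNIV. absv (A $ j $ p j)) < (\<Prod>j\<in>UNIV. absv (A $ j $ j))"
      using i dom[of i "p i"] le nz by (intro prod_mono_strict[of i]) auto
    then show ?thesis by (simp add: abs_sgn absv_prod)
  qed
  have "det A = (\<Sum>p\<in>?P. ?t p)"
    by (simp add: det_def)
  also have "\<dots> = ?t id + (\<Sum>p\<in>?P - {id}. ?t p)"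
    using id by (intro sum.remove) (auto simp: finite_permutations)
  finally have "absv (det A) = absv (?t id + (\<Sum>p\<in>?P - {id}. ?t p))" by simp
  also have "\<dots> = absv (?t id)"
    using small nz by (intro absv_add_eq absv_sum_less) auto
  finally show ?thesis by (simp add: absv_prod)
qed

section \<open>Polynomials inside the field of Laurent series\<close>

lemma poly_ring_iff: "f \<in> poly_ring \<longleftrightarrow> (\<forall>n>0. f $$ n = 0)"
proof -
  have nth: "poly (map_poly fls_const p) fls_X_inv $$ n
      = (if n \<le> 0 then coeff p (nat (- n)) else 0)" for p :: "'a poly" and n
  proof (induction p arbitrary: n)
    case (pCons a p)
    show ?case
      using pCons.IH[of "n + 1"] pCons.hyps
      by (auto simp: map_poly_pCons fls_X_inv_times_conv_shift coeff_pCons nat_eq_iff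
          split: nat.splits)
  qed simp
  show ?thesis
  proof
    assume "f \<in> poly_ring"
    then show "\<forall>n>0. f $$ n = 0" by (auto simp: poly_ring_def nth)
  next
    assume *: "\<forall>n>0. f $$ n = 0"
    \<comment> \<open>\<open>fls_prpart\<close> has constant coefficient 0, so the constant term of
      \<open>f\<close> is added separately.\<close>
    have "f = poly (map_poly fls_const (fls_prpart f + [:f $$ 0:])) fls_X_inv"
      using * by (intro fls_eqI) (auto simp: nth coeff_pCons split: nat.splits)
    then show "f \<in> poly_ring" unfolding poly_ring_def by blast
  qed
qed

lemma poly_ring_diff: "f \<in> poly_ring \<Longrightarrow> g \<in> poly_ring \<Longrightarrow> f - g \<in> poly_ring"
  by (simp add: poly_ring_iff)

lemma poly_ring_prod: "(\<And>i. i \<in> A \<Longrightarrow> f i \<in> poly_ring) \<Longrightarrow> prod f A \<in> poly_ring"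
  by (induction A rule: infinite_finite_induct) (auto intro: poly_ring_1 poly_ring_mult)

lemma poly_ring_of_int: "of_int n \<in> poly_ring"
  by (simp add: poly_ring_iff fls_of_int_nth)

lemma fls_X_inv_in_poly_ring: "fls_X_inv \<in> poly_ring"
  by (simp add: poly_ring_iff)

lemma poly_ring_det:
  fixes A :: "'k::field fls ^ 'd ^ 'd"
  assumes "\<And>i j. A $ i $ j \<in> poly_ring"
  shows "det A \<in> poly_ring"
  unfolding det_def
  using assms by (intro poly_ring_sum poly_ring_mult poly_ring_prod poly_ring_of_int)

lemma absv_poly_ring_ge_1:
  fixes f :: "'k::{finite,field} fls"
  assumes "f \<in> poly_ring" "f \<noteq> 0"
  shows "1 \<le> absv f"
proof -
  have "fls_subdegree f \<le> 0"
    using assms by (metis nth_fls_subdegree_nonzero not_le poly_ring_iff)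
  then show ?thesis
    using assms powi_card_le_iff[where 'k='k, of 0 "- fls_subdegree f"]
    by (simp add: absv_nonzero)
qed

text \<open>Cut off the fractional part: what remains of \<open>f\<close> begins with the term in
  \<open>1/x\<close>.\<close>

lemma poly_ring_approx:
  fixes f :: "'k::{finite,field} fls"
  obtains r where "r \<in> poly_ring" "absv (f - r) \<le> 1 / real CARD('k)"
proof
  define r where "r = Abs_fls (\<lambda>n. if n \<le> 0 then f $$ n else 0)"
  have nth: "r $$ n = (if n \<le> 0 then f $$ n else 0)" for n
    unfolding r_def
    by (intro nth_Abs_fls_lower_bound[of "min 0 (fls_subdegree f)"]) auto
  show "r \<in> poly_ring" by (simp add: poly_ring_iff nth)
  have "absv (f - r) \<le> real CARD('k) powi (-1)"
    unfolding absv_le_powi_iff by (auto simp: nth)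
  then show "absv (f - r) \<le> 1 / real CARD('k)"
    by (simp add: inverse_eq_divide)
qed

section \<open>Topology of the field of Laurent series\<close>

lemma dist_fls_eq_powi:
  "x \<noteq> y \<Longrightarrow> dist x y = 2 powi (- fls_subdegree (x - y))"
  for x y :: "'a::group_add fls"
  by (auto simp: dist_fls_def power_int_def power_one_over inverse_eq_divide)

lemma dist_fls_le_powi_iff:
  "dist x y \<le> 2 powi n \<longleftrightarrow> (\<forall>m < - n. x $$ m = y $$ m)"
  for x y :: "'a::group_add fls"
proof (cases "x = y")
  case False
  then have "dist x y \<le> 2 powi n \<longleftrightarrow> - n \<le> fls_subdegree (x - y)"
    by (subst dist_fls_eq_powi) (auto simp: powi_le_iff)
  also have "\<dots> \<longleftrightarrow> (\<forall>m < - n. (x - y) $$ m = 0)"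
    using False
    by (metis fls_eq0_below_subdegree fls_subdegree_geI less_le_trans right_minus_eq)
  finally show ?thesis by simp
qed simp

lemma ex_two_powi_less:
  assumes "0 < e"
  obtains n :: nat where "2 powi (- int n) < (e :: real)"
proof -
  obtain n where "(1 / 2) ^ n < e"
    using real_arch_pow_inv[OF assms, of "1 / 2"] by auto
  then show ?thesis using that[of n] by (simp add: power_int_minus power_one_over inverse_eq_divide)
qed

text \<open>Along a Cauchy sequence the coefficients below any given exponent become constant
  simultaneously; the limit collects these stable values.\<close>

instance fls :: (group_add) complete_space
proof
  fix X :: "nat \<Rightarrow> 'a fls"
  assume "Cauchy X"
  then have "\<exists>M. \<forall>i\<ge>M. \<forall>j\<ge>M. dist (X i) (X j) \<le> 2 powi (- n)" for n
    using metric_CauchyD[of X "2 powi (- n)"] by (auto intro!: less_imp_le)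
  then have "\<exists>M. \<forall>i\<ge>M. \<forall>j\<ge>M. \<forall>m<n. X i $$ m = X j $$ m" for n
    by (simp add: dist_fls_le_powi_iff)
  then obtain M where M: "\<And>n i j m. i \<ge> M n \<Longrightarrow> j \<ge> M n \<Longrightarrow> m < n \<Longrightarrow> X i $$ m = X j $$ m"
    by metis
  define z where "z = Abs_fls (\<lambda>n. X (M (n + 1)) $$ n)"
  have z: "z $$ n = X (M (n + 1)) $$ n" for n
    unfolding z_def
  proof (rule nth_Abs_fls_lower_bound)
    \<comment> \<open>From stage \<open>M 0\<close> on all terms agree at negative exponents, so the
      subdegree of \<open>X (M 0)\<close> also bounds the support of the limit from below.\<close>
    show "\<forall>n<min 0 (fls_subdegree (X (M 0))). X (M (n + 1)) $$ n = 0"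
    proof (intro allI impI)
      fix n assume n: "n < min 0 (fls_subdegree (X (M 0)))"
      have "X (M (n + 1)) $$ n = X (max (M (n + 1)) (M 0)) $$ n"
        by (rule M[of "n + 1"]) auto
      also have "\<dots> = X (M 0) $$ n"
        using n by (intro M[of 0]) auto
      finally show "X (M (n + 1)) $$ n = 0" using n by simp
    qed
  qed
  have lim: "\<forall>m<n. X i $$ m = z $$ m" if "i \<ge> M n" for i n
  proof (intro allI impI)
    fix m assume "m < n"
    then have "X i $$ m = X (max (M n) (M (m + 1))) $$ m"
      using that by (intro M[of n]) auto
    also have "\<dots> = X (M (m + 1)) $$ m"
      by (rule M[of "m + 1"]) auto
    finally show "X i $$ m = z $$ m" by (simp add: z)
  qed
  have "X \<longlonglongrightarrow> z"
  proof (rule metric_LIMSEQ_I)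
    fix e :: real assume "0 < e"
    then obtain n where n: "2 powi (- int n) < e" by (rule ex_two_powi_less)
    have "dist (X i) z \<le> 2 powi (- int n)" if "i \<ge> M (int n)" for i
      using lim[OF that] by (simp add: dist_fls_le_powi_iff)
    then show "\<exists>N. \<forall>i\<ge>N. dist (X i) z < e"
      using n by (meson le_less_trans)
  qed
  then show "convergent X" by (rule convergentI)
qed

text \<open>A ball of radius \<open>2\<^sup>b\<close> is covered by finitely many balls of radius \<open>2\<^sup>-\<^sup>n\<close>, indexed by the
  finitely many possibilities for the coefficients between \<open>-b\<close> and \<open>n\<close>.\<close>

lemma compact_cball_fls:
  "compact {z :: 'a::{finite,group_add} fls. dist z 0 \<le> 2 powi b}" (is "compact ?S")
proof -
  have "closed ?S"
    by (intro closed_Collect_le continuous_intros)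
  moreover have "\<exists>K. finite K \<and> ?S \<subseteq> (\<Union>x\<in>K. ball x e)" if e: "0 < e" for e
  proof -
    obtain n where n: "2 powi (- int n) < e" using e by (rule ex_two_powi_less)
    define F where "F = {-b..<int n} \<rightarrow>\<^sub>E (UNIV :: 'a set)"
    define c where "c \<phi> = Abs_fls (\<lambda>m. if m \<in> {-b..<int n} then \<phi> m else 0)" for \<phi> :: "int \<Rightarrow> 'a"
    have c: "c \<phi> $$ m = (if m \<in> {-b..<int n} then \<phi> m else 0)" for \<phi> m
      unfolding c_def by (intro nth_Abs_fls_lower_bound[of "-b"]) auto
    have "z \<in> (\<Union>x\<in>c ` F. ball x e)" if "z \<in> ?S" for z
    proof -
      let ?\<phi> = "restrict (fls_nth z) {-b..<int n}"
      have "dist (c ?\<phi>) z \<le> 2 powi (- int n)"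
        using that by (auto simp: dist_fls_le_powi_iff c)
      moreover have "?\<phi> \<in> F" by (auto simp: F_def)
      ultimately show ?thesis using n by (force simp: mem_ball)
    qed
    moreover have "finite (c ` F)"
      unfolding F_def by (intro finite_imageI finite_PiE) auto
    ultimately show ?thesis by blast
  qed
  ultimately show ?thesis
    by (simp add: compact_eq_totally_bounded complete_eq_closed)
qed

text \<open>Closed bounded sets of vectors then become compact, which \<open>compactin_orbit\<close>
  uses.\<close>

instance fls :: ("{finite,group_add}") heine_borel
proof
  fix f :: "nat \<Rightarrow> 'a fls"
  assume "bounded (range f)"
  then obtain B where B: "\<And>n. dist (f n) 0 \<le> B"
    by (auto simp: bounded_any_center[of _ 0] dist_commute)
  obtain b :: nat where "B < 2 ^ b"
    using real_arch_pow[of 2 B] by auto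
  then have "\<forall>n. f n \<in> {z. dist z 0 \<le> 2 powi int b}"
    using B by (auto intro: order.trans less_imp_le)
  then show "\<exists>l r. strict_mono r \<and> (f \<circ> r) \<longlonglongrightarrow> l"
    using compact_imp_seq_compact[OF compact_cball_fls] unfolding seq_compact_def by blast
qed

text \<open>Multiplication by \<open>c\<close> adds its subdegree to that of a difference, so it is
  Lipschitz.\<close>

lemma continuous_on_fls_mult_right:
  fixes f :: "'b::topological_space \<Rightarrow> 'k::field fls"
  assumes "continuous_on S f"
  shows "continuous_on S (\<lambda>x. f x * c)"
proof -
  have dist: "dist (x * c) (y * c) \<le> 2 powi (- fls_subdegree c) * dist x y" for x y :: "'k fls"
  proof (cases "x = y \<or> c = 0")
    case False
    then have "fls_subdegree (x * c - y * c) = fls_subdegree (x - y) + fls_subdegree c"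
      by (simp flip: left_diff_distrib)
    with False show ?thesis by (simp add: dist_fls_eq_powi add.commute flip: power_int_add)
  qed auto
  have "continuous_on UNIV (\<lambda>x :: 'k fls. x * c)"
    unfolding continuous_on_iff
  proof (intro ballI allI impI)
    fix x :: "'k fls" and e :: real assume "0 < e"
    let ?C = "2 powi (- fls_subdegree c) :: real"
    have C: "?C > 0" by simp
    have "dist (y * c) (x * c) < e" if "dist y x < e / ?C" for y
      using dist[of y x] that C by (simp add: pos_less_divide_eq mult.commute)
    then show "\<exists>d>0. \<forall>y\<in>UNIV. dist y x < d \<longrightarrow> dist (y * c) (x * c) < e"
      using \<open>0 < e\<close> C by (intro exI[of _ "e / ?C"]) auto
  qed
  then show ?thesis
    using continuous_on_compose2[OF _ assms, of UNIV "\<lambda>x. x * c"] by simp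
qed

section \<open>Chip firing on a weighted complete graph\<close>

text \<open>Increasing \<open>m j\<close> by one changes the energy \<open>F\<close> of the proof by twice the difference of the two sides
  of the inequality, so the inequality holds at a minimum of \<open>F\<close>.\<close>

lemma energy_minimizer:
  fixes n :: "'d::finite \<Rightarrow> 'd \<Rightarrow> int" and t :: "'d \<Rightarrow> int" and d :: int
  assumes sym: "\<And>i j. n i j = n j i" and diag: "\<And>i. n i i = 0"
    and pos: "\<And>i j. i \<noteq> j \<Longrightarrow> 1 \<le> n i j"
    and t: "(\<Sum>j\<in>UNIV. t j) = 0" and d: "1 \<le> d"
  obtains m :: "'d \<Rightarrow> nat" where
    "\<And>j. t j + 2 * d * (\<Sum>i\<in>UNIV. n i j * (int (m i) - int (m j))) \<le> d * (\<Sum>i\<in>UNIV. n i j)"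
proof -
  define E where "E m = (\<Sum>i\<in>UNIV. \<Sum>j\<in>UNIV. n i j * (int (m i) - int (m j))\<^sup>2)" for m :: "'d \<Rightarrow> nat"
  define F where "F m = d * E m - 2 * (\<Sum>j\<in>UNIV. t j * int (m j))" for m
  \<comment> \<open>Since \<open>t\<close> sums to 0, \<open>F\<close> does not change when a
    constant is added to \<open>m\<close>. So heights can be measured from one vertex
    \<open>k\<close>, and the edges at \<open>k\<close>, of weight at least 1, already bound the
    squares of these heights by the energy.\<close>
  obtain k :: 'd where True by simp
  have bounded: "- (\<Sum>j\<in>UNIV. (t j)\<^sup>2) \<le> F m" for m
  proof -
    define z where "z j = int (m j) - int (m k)" for j
    have "(\<Sum>j\<in>UNIV. t j * int (m j)) = (\<Sum>j\<in>UNIV. t j * z j)"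
    proof -
      have "(\<Sum>j\<in>UNIV. t j * z j) = (\<Sum>j\<in>UNIV. t j * int (m j)) - (\<Sum>j\<in>UNIV. t j) * int (m k)"
        by (simp only: z_def right_diff_distrib sum_subtractf sum_distrib_right)
      then show ?thesis by (simp add: t)
    qed
    moreover have "(\<Sum>j\<in>UNIV. (z j)\<^sup>2) \<le> d * E m"
    proof -
      have n_nonneg: "0 \<le> n i j" for i j
        using diag[of i] pos[of i j] by (cases "i = j") auto
      have "(z j)\<^sup>2 \<le> n k j * (int (m k) - int (m j))\<^sup>2" for j
      proof (cases "j = k")
        case False
        have "1 * (int (m k) - int (m j))\<^sup>2 \<le> n k j * (int (m k) - int (m j))\<^sup>2"
          using pos[of k j] False by (intro mult_right_mono) auto
        then show ?thesis by (simp add: z_def power2_commute)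
      qed (simp add: z_def)
      then have "(\<Sum>j\<in>UNIV. (z j)\<^sup>2) \<le> (\<Sum>j\<in>UNIV. n k j * (int (m k) - int (m j))\<^sup>2)"
        by (rule sum_mono)
      also have "\<dots> \<le> E m"
        unfolding E_def using n_nonneg
        by (intro member_le_sum[of k UNIV "\<lambda>i. \<Sum>j\<in>UNIV. n i j * (int (m i) - int (m j))\<^sup>2"])
          (auto intro!: sum_nonneg)
      also have "\<dots> \<le> d * E m"
      proof -
        have "0 \<le> E m" unfolding E_def using n_nonneg by (intro sum_nonneg) auto
        then show ?thesis using mult_right_mono[OF d, of "E m"] by simp
      qed
      finally show ?thesis .
    qed
    moreover have "- (\<Sum>j\<in>UNIV. (t j)\<^sup>2) \<le> (\<Sum>j\<in>UNIV. (z j)\<^sup>2) - 2 * (\<Sum>j\<in>UNIV. t j * z j)"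
    proof -
      have "0 \<le> (\<Sum>j\<in>UNIV. (z j - t j)\<^sup>2)" by (intro sum_nonneg) auto
      also have "\<dots> = (\<Sum>j\<in>UNIV. (z j)\<^sup>2) - 2 * (\<Sum>j\<in>UNIV. t j * z j) + (\<Sum>j\<in>UNIV. (t j)\<^sup>2)"
        by (simp add: power2_diff sum.distrib sum_subtractf sum_distrib_left algebra_simps)
      finally show ?thesis by simp
    qed
    ultimately show ?thesis by (simp add: F_def)
  qed
  \<comment> \<open>An integer-valued function that is bounded below attains its minimum.\<close>
  obtain m where m: "\<And>m'. F m \<le> F m'"
  proof -
    let ?G = "\<lambda>m. nat (F m + (\<Sum>j\<in>UNIV. (t j)\<^sup>2))"
    obtain m where m: "\<And>m'. ?G m \<le> ?G m'"
      using ex_has_least_nat[of "\<lambda>_. True" _ ?G] by auto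
    have "F m \<le> F m'" for m'
      using m[of m'] bounded[of m] bounded[of m'] by linarith
    then show ?thesis by (rule that)
  qed
  have "t j + 2 * d * (\<Sum>i\<in>UNIV. n i j * (int (m i) - int (m j))) \<le> d * (\<Sum>i\<in>UNIV. n i j)" for j
  proof -
    let ?m = "m(j := Suc (m j))"
    let ?v = "\<Sum>i\<in>UNIV. n i j" and ?s = "\<Sum>i\<in>UNIV. n i j * (int (m i) - int (m j))"
    let ?D = "\<lambda>i l. n i l * (int (?m i) - int (?m l))\<^sup>2 - n i l * (int (m i) - int (m l))\<^sup>2"
    \<comment> \<open>Only edges at \<open>j\<close> change, and \<open>E\<close> counts each edge
      in both orders; hence the factor 2 below.\<close>
    have D: "?D i l = (if l = j then n i j * (1 - 2 * (int (m i) - int (m j))) else 0)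
        + (if i = j then n l j * (1 - 2 * (int (m l) - int (m j))) else 0)" for i l
      using diag[of j] sym[of j l] by (auto simp: power2_eq_square algebra_simps)
    have "E ?m - E m = (\<Sum>i\<in>UNIV. \<Sum>l\<in>UNIV. ?D i l)"
      by (simp add: E_def sum_subtractf)
    also have "\<dots> = 2 * (\<Sum>i\<in>UNIV. n i j * (1 - 2 * (int (m i) - int (m j))))"
    proof -
      have "(\<Sum>l\<in>UNIV. if i = j then f l else 0) = (if i = j then sum f UNIV else 0)"
        for f :: "'d \<Rightarrow> int" and i
        by simp
      then show ?thesis unfolding D sum.distrib by simp
    qed
    also have "(\<Sum>i\<in>UNIV. n i j * (1 - 2 * (int (m i) - int (m j)))) = ?v - 2 * ?s"
      by (simp add: algebra_simps sum.distrib sum_subtractf sum_distrib_left)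
    finally have E: "E ?m = E m + 2 * (?v - 2 * ?s)" by linarith
    have "(\<Sum>l\<in>UNIV. t l * int (?m l)) = (\<Sum>l\<in>UNIV. t l * int (m l) + (if l = j then t l else 0))"
      by (intro sum.cong) (auto simp: algebra_simps)
    then have "(\<Sum>l\<in>UNIV. t l * int (?m l)) = (\<Sum>l\<in>UNIV. t l * int (m l)) + t j"
      by (simp add: sum.distrib)
    then have "F ?m = F m + 2 * (d * (?v - 2 * ?s) - t j)"
      unfolding F_def E by (simp add: algebra_simps)
    then have "F m \<le> F m + 2 * (d * (?v - 2 * ?s) - t j)" using m[of ?m] by argo
    then show ?thesis by (simp add: algebra_simps)
  qed
  then show ?thesis by (rule that)
qed

text \<open>For \<open>\<Sum> y < W\<close> the bound says that the divisor \<open>(\<Sum>\<^sub>i n i j) - 1 - y j\<close> is linearly equivalent to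
  an effective one, as in Riemann's inequality for graphs.\<close>

lemma firing_bound:
  fixes n :: "'d::finite \<Rightarrow> 'd \<Rightarrow> int" and y :: "'d \<Rightarrow> int"
  assumes sym: "\<And>i j. n i j = n j i" and diag: "\<And>i. n i i = 0"
    and pos: "\<And>i j. i \<noteq> j \<Longrightarrow> 1 \<le> n i j"
    and W: "2 * W = (\<Sum>j\<in>UNIV. \<Sum>i\<in>UNIV. n i j)"
  obtains m :: "'d \<Rightarrow> nat" where
    "\<And>j. int CARD('d) * (y j + (\<Sum>i\<in>UNIV. n i j * (int (m i) - int (m j))))
       \<le> int CARD('d) * (\<Sum>i\<in>UNIV. n i j) - (W - (\<Sum>i\<in>UNIV. y i))"
proof -
  define d where "d = int CARD('d)"
  have d: "1 \<le> d" by (simp add: d_def Suc_leI)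
  \<comment> \<open>The last summand spreads the deficit \<open>W - sum y\<close> evenly over the
    vertices, so that \<open>t\<close> sums to 0. Halving the inequality of
    \<open>energy_minimizer\<close> for this \<open>t\<close> gives the claim.\<close>
  define t where "t j = 2 * d * y j - d * (\<Sum>i\<in>UNIV. n i j) + 2 * (W - (\<Sum>i\<in>UNIV. y i))" for j
  have "(\<Sum>j\<in>UNIV. t j) = 2 * d * (\<Sum>j\<in>UNIV. y j) - d * (2 * W) + d * (2 * (W - (\<Sum>i\<in>UNIV. y i)))"
    unfolding W t_def by (simp add: sum.distrib sum_subtractf d_def flip: sum_distrib_left)
  also have "\<dots> = 0" by (simp add: algebra_simps)
  finally obtain m where m: "\<And>j. t j + 2 * d * (\<Sum>i\<in>UNIV. n i j * (int (m i) - int (m j)))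
      \<le> d * (\<Sum>i\<in>UNIV. n i j)"
    using energy_minimizer[of n t d] sym diag pos d by blast
  show ?thesis
  proof (rule that)
    show "int CARD('d) * (y j + (\<Sum>i\<in>UNIV. n i j * (int (m i) - int (m j))))
       \<le> int CARD('d) * (\<Sum>i\<in>UNIV. n i j) - (W - (\<Sum>i\<in>UNIV. y i))" for j
      using m[of j] unfolding t_def d_def[symmetric] by (simp add: algebra_simps)
  qed
qed

section \<open>Lattices and orbits\<close>

lemma lattice_of_iff:
  "w \<in> lattice_of g \<longleftrightarrow> (\<exists>u. (\<forall>i. u $ i \<in> poly_ring) \<and> w = g *v u)"
  by (auto simp: lattice_of_def)

lemma lattice_of_mult: "lattice_of (a ** g) = (\<lambda>v. a *v v) ` lattice_of g"
  by (auto simp: lattice_of_def image_image matrix_vector_mul_assoc)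

lemma mat_scalar_commute: "mat c ** g = g ** (mat c :: 'k::field fls ^ 'd ^ 'd)"
  by (simp add: matrix_matrix_mult_def mat_def vec_eq_iff mult_delta_left mult_delta_right mult.commute)

lemma invertible_mat_scalar:
  assumes "c \<noteq> 0"
  shows "invertible (mat c :: 'k::field fls ^ 'd ^ 'd)"
proof -
  have "mat c ** mat (inverse c) = (mat 1 :: 'k fls ^ 'd ^ 'd)"
       "mat (inverse c) ** mat c = (mat 1 :: 'k fls ^ 'd ^ 'd)"
    using assms by (simp_all add: mat_mult_mat)
  then show ?thesis unfolding invertible_def by blast
qed

lemma GL_mult: "a \<in> GL \<Longrightarrow> b \<in> GL \<Longrightarrow> a ** b \<in> GL"
  by (simp add: GL_def invertible_mult)

lemma mem_pgl_proj: "g \<in> pgl_proj g"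
  unfolding pgl_proj_def by (intro CollectI exI[of _ 1]) simp

lemma lattice_class_scale:
  assumes "c \<noteq> 0"
  shows "lattice_of ` pgl_proj (mat c ** g) = lattice_of ` pgl_proj g"
  by (simp add: assms pgl_proj_scale)

text \<open>Left multiplication acts on the lattice itself, whichever matrix represents it. So a
  unit that stabilises the lattice can be absorbed.\<close>

lemma lattice_class_cong:
  assumes "lattice_of g = lattice_of h"
  shows "lattice_of ` pgl_proj (a ** g) = lattice_of ` pgl_proj (a ** h)"
proof -
  have "lattice_of ` pgl_proj (a ** m) = {(\<lambda>v. (mat c ** a) *v v) ` lattice_of m | c. c \<noteq> 0}" for m
    by (auto simp: pgl_proj_def matrix_mul_assoc lattice_of_mult[symmetric])
  then show ?thesis using assms by simp
qed

text \<open>Scalar matrices are central, so the homothety factors of both classes merge into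
  one.\<close>

lemma act_lattice_class:
  "act (pgl_proj a) (lattice_of ` pgl_proj g) = lattice_of ` pgl_proj (a ** g)"
proof (intro subset_antisym subsetI)
  fix L assume "L \<in> act (pgl_proj a) (lattice_of ` pgl_proj g)"
  then obtain b c where bc: "b \<noteq> 0" "c \<noteq> 0"
    and L: "L = lattice_of ((mat b ** a) ** (mat c ** g))"
    unfolding act_def pgl_proj_def by (auto simp: lattice_of_mult)
  have "(mat b ** a) ** (mat c ** g) = mat (b * c) ** (a ** g)"
    by (metis mat_mult_mat mat_scalar_commute matrix_mul_assoc)
  moreover have "b * c \<noteq> 0" using bc by simp
  ultimately show "L \<in> lattice_of ` pgl_proj (a ** g)"
    unfolding pgl_proj_def L by blast
next
  fix L assume "L \<in> lattice_of ` pgl_proj (a ** g)"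
  then obtain c where "c \<noteq> 0" "L = (\<lambda>v. (mat c ** a) *v v) ` lattice_of g"
    unfolding pgl_proj_def by (auto simp: matrix_mul_assoc lattice_of_mult[symmetric])
  then show "L \<in> act (pgl_proj a) (lattice_of ` pgl_proj g)"
    unfolding act_def using mem_pgl_proj[of g] by (auto simp: pgl_proj_def)
qed

lemma continuous_map_lattice_class:
  "continuous_map (subtopology euclidean GL) lattice_space (\<lambda>h. lattice_of ` pgl_proj h)"
  unfolding lattice_space_def PGL_topology_def
  using continuous_map_compose[OF quotient_imp_continuous_map[OF quotient_map_quotient_topology]
      quotient_imp_continuous_map[OF quotient_map_quotient_topology]]
  by (simp add: o_def)

lemma lattice_class_in_topspace: "g \<in> GL \<Longrightarrow> lattice_of ` pgl_proj g \<in> topspace lattice_space"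
  by (simp add: lattice_space_def PGL_topology_def)

section \<open>Diagonal matrices and their orbits\<close>

definition diag_mat :: "'k::field fls ^ 'd \<Rightarrow> 'k fls ^ 'd ^ 'd" where
  "diag_mat t = (\<chi> i j. if i = j then t $ i else 0)"

lemma diag_mat_mult_vec: "diag_mat t *v v = t * v"
  by (simp add: diag_mat_def matrix_vector_mult_def vec_eq_iff mult_delta_left)

lemma diag_mat_mult: "diag_mat t ** g = (\<chi> i j. t $ i * g $ i $ j)"
  by (simp add: diag_mat_def matrix_matrix_mult_def vec_eq_iff mult_delta_left)

lemma diag_mat_mult_diag_mat: "diag_mat s ** diag_mat t = diag_mat (s * t)"
  by (simp add: diag_mat_mult) (simp add: diag_mat_def vec_eq_iff)

lemma mat_eq_diag_mat: "mat c = diag_mat (\<chi> i. c)"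
  by (simp add: diag_mat_def mat_def vec_eq_iff)

lemma det_diag_mat: "det (diag_mat t) = (\<Prod>i\<in>UNIV. t $ i)"
  by (subst det_diagonal) (auto simp: diag_mat_def)

lemma diag_mat_in_GL_iff: "diag_mat t \<in> GL \<longleftrightarrow> (\<forall>i. t $ i \<noteq> 0)"
  by (simp add: GL_def invertible_det_nz det_diag_mat)

lemma diag_group_eq: "diag_group = (\<lambda>t. pgl_proj (diag_mat t)) ` {t. \<forall>i. t $ i \<noteq> 0}"
proof -
  have "{a \<in> GL. \<forall>i j. i \<noteq> j \<longrightarrow> a $ i $ j = 0} = diag_mat ` {t. \<forall>i. t $ i \<noteq> 0}" (is "?l = ?r")
  proof (intro subset_antisym subsetI)
    fix a assume a: "a \<in> ?l"
    then have "a = diag_mat (\<chi> i. a $ i $ i)"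
      by (auto simp: diag_mat_def vec_eq_iff)
    then show "a \<in> ?r"
      using a diag_mat_in_GL_iff[of "\<chi> i. a $ i $ i"] by auto
  qed (auto simp: diag_mat_in_GL_iff[symmetric], simp add: diag_mat_def)
  then have "diag_group = pgl_proj ` diag_mat ` {t :: 'a fls ^ 'b. \<forall>i. t $ i \<noteq> 0}"
    by (rule subst) (rule diag_group_def)
  then show ?thesis by (simp only: image_image)
qed

lemma diag_orbit_lattice_class:
  "diag_orbit (lattice_of ` pgl_proj g)
     = (\<lambda>t. lattice_of ` pgl_proj (diag_mat t ** g)) ` {t. \<forall>i. t $ i \<noteq> 0}"
  by (simp only: diag_orbit_def diag_group_eq image_image act_lattice_class)

section \<open>Covolume and the evaluation of \<open>mu\<close>\<close>

lemma absv_det_GL_poly: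
  fixes \<gamma> :: "'k::{finite,field} fls ^ 'd ^ 'd"
  assumes "\<gamma> \<in> GL_poly"
  shows "absv (det \<gamma>) = 1"
proof -
  obtain h where \<gamma>: "\<forall>i j. \<gamma> $ i $ j \<in> poly_ring" and h: "\<forall>i j. h $ i $ j \<in> poly_ring"
    and "\<gamma> ** h = mat 1"
    using assms unfolding GL_poly_def by blast
  from this(3) have 1: "det \<gamma> * det h = 1" by (metis det_I det_mul)
  \<comment> \<open>Both determinants are nonzero polynomials, and their product is 1.\<close>
  have "1 \<le> absv (det \<gamma>)" "1 \<le> absv (det h)"
    using \<gamma> h 1 by (intro absv_poly_ring_ge_1 poly_ring_det; force)+
  moreover have "absv (det \<gamma>) * absv (det h) = 1"
    using 1 by (metis absv_1 absv_mult)
  ultimately show ?thesis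
    using mult_left_mono[of 1 "absv (det h)" "absv (det \<gamma>)"] by simp
qed

text \<open>Two matrices of one lattice differ by an element of \<open>GL_poly\<close>; thus
  \<open>absv (det g)\<close> is the covolume of the lattice.\<close>

lemma absv_det_lattice_eq:
  fixes g h :: "'k::{finite,field} fls ^ 'd ^ 'd"
  assumes "g \<in> GL" "h \<in> GL" "lattice_of g = lattice_of h"
  shows "absv (det g) = absv (det h)"
  using lattice_eqD[of g h] assms
  by (auto simp: GL_def det_mul absv_mult absv_det_GL_poly)

lemma Nprod_mult: "Nprod (s * t) = Nprod s * Nprod t"
  by (simp add: Nprod_def absv_mult prod.distrib)

lemma Nprod_nonneg: "0 \<le> Nprod v"
  by (simp add: Nprod_def prod_nonneg)

lemma absv_det_diag_mat: "absv (det (diag_mat t)) = Nprod t"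
  by (simp add: det_diag_mat absv_prod Nprod_def)

lemma lattice_of_diag_mat_mult: "lattice_of (diag_mat t ** g) = (\<lambda>v. t * v) ` lattice_of g"
  by (simp add: lattice_of_mult diag_mat_mult_vec)

text \<open>The matrix \<open>h\<close> picked by the definition of \<open>mu\<close> has
  \<open>b\<close> times the lattice of \<open>g\<close>. Norms and covolume scale by the same
  factor \<open>Nprod ?b\<close>, so both bounds carry over from \<open>g\<close> to
  \<open>h\<close>.\<close>

lemma mu_lattice_class_eqI:
  fixes g :: "'k::{finite,field} fls ^ 'd ^ 'd"
  assumes g: "g \<in> GL"
    and upper: "\<And>v. \<exists>u\<in>lattice_of g. Nprod (v - u) \<le> c * absv (det g)"
    and lower: "\<And>u. u \<in> lattice_of g \<Longrightarrow> c * absv (det g) \<le> Nprod (v0 - u)"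
  shows "mu (lattice_of ` pgl_proj g) = c"
proof -
  define h where "h = (SOME h. h \<in> GL \<and> lattice_of ` pgl_proj g = lattice_of ` pgl_proj h)"
  have "h \<in> GL \<and> lattice_of ` pgl_proj g = lattice_of ` pgl_proj h"
    unfolding h_def by (rule someI[of _ g]) (use g in auto)
  then have h: "h \<in> GL" and "lattice_of h \<in> lattice_of ` pgl_proj g"
    using mem_pgl_proj[of h] by auto
  then obtain b where b: "b \<noteq> 0" "lattice_of h = lattice_of (mat b ** g)"
    by (auto simp: pgl_proj_def)
  let ?b = "(\<chi> i. b) :: 'k fls ^ 'd"
  have "mat b ** g \<in> GL"
    using g b by (simp add: GL_def invertible_mult invertible_mat_scalar)
  then have det: "absv (det h) = Nprod ?b * absv (det g)"
    using absv_det_lattice_eq[OF h _ b(2)]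
    by (simp add: det_mul absv_mult mat_eq_diag_mat absv_det_diag_mat)
  have Nb: "Nprod ?b > 0" using b by (auto simp: Nprod_def intro!: prod_pos)
  have L: "lattice_of h = (\<lambda>v. ?b * v) ` lattice_of g"
    by (simp add: b(2) mat_eq_diag_mat lattice_of_diag_mat_mult)
  have N: "Nprod (?b * v - ?b * u) = Nprod ?b * Nprod (v - u)" for u v :: "'k fls ^ 'd"
    by (simp add: Nprod_mult flip: right_diff_distrib)
  have bdd: "bdd_below ((\<lambda>u. Nprod (v - u)) ` S)" for v :: "'k fls ^ 'd" and S
    by (rule bdd_belowI[of _ 0]) (auto simp: Nprod_nonneg)
  have up: "(INF u\<in>lattice_of h. Nprod (v - u)) \<le> c * absv (det h)" for v
  proof -
    define w :: "'k fls ^ 'd" where "w = (\<chi> i. v $ i / b)"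
    have v: "v = ?b * w" using b by (simp add: w_def vec_eq_iff)
    obtain u where u: "u \<in> lattice_of g" "Nprod (w - u) \<le> c * absv (det g)"
      using upper by blast
    have "(INF u\<in>lattice_of h. Nprod (v - u)) \<le> Nprod (v - ?b * u)"
      by (rule cINF_lower[OF bdd]) (use u L in auto)
    also have "\<dots> = Nprod ?b * Nprod (w - u)" unfolding v N ..
    also have "\<dots> \<le> Nprod ?b * (c * absv (det g))" using u Nb by (intro mult_left_mono) auto
    finally show ?thesis by (simp add: det mult_ac)
  qed
  have ne: "lattice_of h \<noteq> {}"
    by (auto simp: lattice_of_def intro!: exI[of _ 0] poly_ring_0)
  have low: "c * absv (det h) \<le> (INF u\<in>lattice_of h. Nprod (?b * v0 - u))"
  proof (rule cINF_greatest[OF ne])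
    fix u assume "u \<in> lattice_of h"
    then obtain u' where u': "u' \<in> lattice_of g" "u = ?b * u'" using L by auto
    have "Nprod ?b * (c * absv (det g)) \<le> Nprod ?b * Nprod (v0 - u')"
      using lower[OF u'(1)] Nb by (intro mult_left_mono) auto
    then show "c * absv (det h) \<le> Nprod (?b * v0 - u)"
      unfolding det u'(2) N by (simp add: mult_ac)
  qed
  \<comment> \<open>The supremum is a maximum, attained at the scaled vector
    \<open>?b * v0\<close>.\<close>
  have "(SUP v. INF u\<in>lattice_of h. Nprod (v - u)) = c * absv (det h)"
  proof (rule cSup_eq_maximum)
    have "c * absv (det h) = (INF u\<in>lattice_of h. Nprod (?b * v0 - u))"
      by (rule order.antisym[OF low up])
    then show "c * absv (det h) \<in> range (\<lambda>v. INF u\<in>lattice_of h. Nprod (v - u))"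
      by (rule range_eqI)
  qed (use up in blast)
  moreover have "absv (det h) > 0"
    using h by (simp add: GL_def invertible_det_nz)
  ultimately show ?thesis
    unfolding mu_def Let_def h_def[symmetric] by simp
qed

section \<open>Lagrange interpolation\<close>

lemma coeff_prod_monic_linear:
  fixes a :: "'i \<Rightarrow> 'a::idom"
  assumes "finite A"
  shows "degree (\<Prod>i\<in>A. [:- a i, 1:]) = card A"
    and "coeff (\<Prod>i\<in>A. [:- a i, 1:]) (card A) = 1"
proof -
  show deg: "degree (\<Prod>i\<in>A. [:- a i, 1:]) = card A"
    by (subst degree_prod_sum_eq) auto
  show "coeff (\<Prod>i\<in>A. [:- a i, 1:]) (card A) = 1"
    using lead_coeff_prod[of "\<lambda>i. [:- a i, 1:]" A] unfolding deg by simp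
qed

text \<open>\<open>P\<close> equals its Lagrange interpolant \<open>?H\<close>, both having degree
  below the number of nodes. The products \<open>?l j\<close> are monic of degree
  \<open>CARD('d) - 1\<close>, so the top coefficient of \<open>?H\<close> is the sum of the
  \<open>?c j\<close>.\<close>

lemma lagrange_leading_coeff:
  fixes \<alpha> :: "'d::finite \<Rightarrow> 'a::field"
  assumes inj: "inj \<alpha>" and deg: "degree P < CARD('d)"
  shows "coeff P (CARD('d) - 1) = (\<Sum>j\<in>UNIV. poly P (\<alpha> j) / (\<Prod>i\<in>UNIV-{j}. \<alpha> j - \<alpha> i))"
proof -
  let ?c = "\<lambda>j. poly P (\<alpha> j) / (\<Prod>i\<in>UNIV-{j}. \<alpha> j - \<alpha> i)"
  let ?l = "\<lambda>j. \<Prod>i\<in>UNIV-{j}. [:- \<alpha> i, 1:]"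
  let ?H = "\<Sum>j\<in>UNIV. smult (?c j) (?l j)"
  have card: "card (UNIV - {j}) = CARD('d) - 1" for j :: 'd by simp
  have "P = ?H"
  proof (rule poly_eqI_degree[of "range \<alpha>"])
    show "degree P < card (range \<alpha>)" using deg inj by (simp add: card_image)
    have "degree ?H \<le> CARD('d) - 1"
      by (intro degree_sum_le order.trans[OF degree_smult_le])
        (auto simp: coeff_prod_monic_linear(1))
    then show "degree ?H < card (range \<alpha>)"
      using inj deg by (simp add: card_image)
    fix x assume "x \<in> range \<alpha>"
    then obtain k where k: "x = \<alpha> k" by blast
    have "poly (smult (?c j) (?l j)) x = (if j = k then poly P x else 0)" for j
    proof (cases "j = k")
      case True
      have "(\<Prod>i\<in>UNIV-{k}. \<alpha> k - \<alpha> i) \<noteq> 0"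
        using inj by (auto simp: inj_def)
      with True show ?thesis by (simp add: poly_prod k)
    next
      case False
      then have "(\<Prod>i\<in>UNIV-{j}. \<alpha> k - \<alpha> i) = 0"
        by (intro prod_zero) auto
      with False show ?thesis by (simp add: poly_prod k)
    qed
    then show "poly P x = poly ?H x"
      by (simp add: poly_sum)
  qed
  then have "coeff P (CARD('d) - 1) = coeff ?H (CARD('d) - 1)" by simp
  also have "\<dots> = (\<Sum>j\<in>UNIV. ?c j)"
  proof -
    have "coeff (?l j) (CARD('d) - 1) = 1" for j
      using coeff_prod_monic_linear(2)[of "UNIV - {j}" \<alpha>] by simp
    then show ?thesis by (simp add: coeff_sum)
  qed
  finally show ?thesis .
qed

section \<open>Lattices as discrete modules, and norms as exponents\<close>

lemma lattice_of_add: "v \<in> lattice_of g \<Longrightarrow> w \<in> lattice_of g \<Longrightarrow> v + w \<in> lattice_of g"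
proof -
  assume "v \<in> lattice_of g" "w \<in> lattice_of g"
  then obtain u u' where "\<forall>i. u $ i \<in> poly_ring" "v = g *v u" "\<forall>i. u' $ i \<in> poly_ring" "w = g *v u'"
    by (auto simp: lattice_of_iff)
  then show ?thesis
    unfolding lattice_of_iff
    by (intro exI[of _ "u + u'"]) (auto simp: matrix_vector_right_distrib poly_ring_add)
qed

lemma lattice_of_smult: "c \<in> poly_ring \<Longrightarrow> v \<in> lattice_of g \<Longrightarrow> c *s v \<in> lattice_of g"
proof -
  assume c: "c \<in> poly_ring" and "v \<in> lattice_of g"
  then obtain u where "\<forall>i. u $ i \<in> poly_ring" "v = g *v u"
    by (auto simp: lattice_of_iff)
  then show ?thesis
    unfolding lattice_of_iff using c
    by (intro exI[of _ "c *s u"]) (auto simp: vector_scalar_commute poly_ring_mult)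
qed

lemma lattice_of_0: "0 \<in> lattice_of g"
  by (auto simp: lattice_of_iff intro!: exI[of _ 0] poly_ring_0)

lemma lattice_of_sum: "(\<And>i. i \<in> A \<Longrightarrow> f i \<in> lattice_of g) \<Longrightarrow> sum f A \<in> lattice_of g"
  by (induction A rule: infinite_finite_induct) (auto intro: lattice_of_add lattice_of_0)

text \<open>If the entries of the inverse of \<open>g\<close> are at most \<open>q powi C\<close>, a
  lattice vector bounded by \<open>q powi (-C-1)\<close> has polynomial coordinates of absolute
  value less than 1, and these vanish.\<close>

lemma lattice_of_discrete:
  fixes g :: "'k::{finite,field} fls ^ 'd ^ 'd"
  assumes "g \<in> GL"
  obtains B :: int where
    "\<And>u. u \<in> lattice_of g \<Longrightarrow> \<forall>j. absv (u $ j) \<le> real CARD('k) powi B \<Longrightarrow> u = 0"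
proof -
  obtain h where h: "h ** g = mat 1" using assms by (auto simp: GL_def invertible_def)
  define C where "C = (\<Sum>i\<in>UNIV. \<Sum>j\<in>UNIV. \<bar>fls_subdegree (h $ i $ j)\<bar>)"
  have C: "absv (h $ i $ j) \<le> real CARD('k) powi C" for i j
  proof -
    have "\<bar>fls_subdegree (h $ i $ j)\<bar> \<le> (\<Sum>j\<in>UNIV. \<bar>fls_subdegree (h $ i $ j)\<bar>)"
      by (rule member_le_sum) auto
    also have "\<dots> \<le> C"
      unfolding C_def
      by (rule member_le_sum[of i UNIV "\<lambda>i. \<Sum>j\<in>UNIV. \<bar>fls_subdegree (h $ i $ j)\<bar>"])
        (auto intro: sum_nonneg)
    finally have "- fls_subdegree (h $ i $ j) \<le> C" by linarith
    then show ?thesis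
      by (cases "h $ i $ j = 0") (auto simp: absv_nonzero powi_card_le_iff)
  qed
  show ?thesis
  proof (rule that)
    fix u assume "u \<in> lattice_of g" and u: "\<forall>j. absv (u $ j) \<le> real CARD('k) powi (- C - 1)"
    then obtain r where r: "\<forall>i. r $ i \<in> poly_ring" "u = g *v r" by (auto simp: lattice_of_iff)
    have "h *v u = r" by (simp add: r(2) matrix_vector_mul_assoc h)
    moreover have "absv ((h *v u) $ i) \<le> real CARD('k) powi (- 1)" for i
    proof -
      have "absv (h $ i $ j * u $ j) \<le> real CARD('k) powi C * real CARD('k) powi (- C - 1)" for j
        unfolding absv_mult using C u by (intro mult_mono) auto
      also have "real CARD('k) powi C * real CARD('k) powi (- C - 1) = real CARD('k) powi (- 1)"
        by (simp flip: power_int_add)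
      finally show ?thesis
        unfolding matrix_vector_mult_def by (auto intro!: absv_sum_le)
    qed
    ultimately have "absv (r $ i) < 1" for i
      using absv_less_powi_iff[where 'k='k, of "r $ i" 0] by (metis diff_0 power_int_0_right)
    then have "r $ i = 0" for i
      using r(1) absv_poly_ring_ge_1[of "r $ i"] by (metis not_less)
    then have "r = 0" by (simp add: vec_eq_iff)
    then show "u = 0" by (simp add: r(2))
  qed
qed

lemma prod_powi_card:
  "(\<Prod>i\<in>A. real CARD('k::{finite,field}) powi f i) = real CARD('k) powi (\<Sum>i\<in>A. f i)"
  by (induction A rule: infinite_finite_induct) (auto simp: power_int_add)

lemma Nprod_less_powi:
  fixes v :: "'k::{finite,field} fls ^ 'd"
  assumes "Nprod v < real CARD('k) powi C"
  obtains y :: "'d \<Rightarrow> int" where "\<And>j. absv (v $ j) \<le> real CARD('k) powi (y j)" "(\<Sum>j\<in>UNIV. y j) < C"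
proof (cases "\<exists>k. v $ k = 0")
  case False
  then have "Nprod v = (\<Prod>j\<in>UNIV. real CARD('k) powi (- fls_subdegree (v $ j)))"
    by (simp add: Nprod_def absv_nonzero)
  also have "\<dots> = real CARD('k) powi (\<Sum>j\<in>UNIV. - fls_subdegree (v $ j))"
    by (simp add: prod_powi_card)
  finally show ?thesis
    using assms False powi_card_less_iff[where 'k='k]
    by (intro that[of "\<lambda>j. - fls_subdegree (v $ j)"]) (auto simp: absv_nonzero)
next
  case True
  then obtain k where k: "v $ k = 0" by blast
  define s where "s j = \<bar>fls_subdegree (v $ j)\<bar>" for j
  \<comment> \<open>Any exponent bounds the zero entry at \<open>k\<close>, so it is chosen to pull
    the sum down to \<open>- \<bar>C\<bar> - 1\<close>.\<close>
  define y where "y j = (if j = k then - \<bar>C\<bar> - 1 - (\<Sum>j\<in>UNIV-{k}. s j) else s j)" for j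
  have "(\<Sum>j\<in>UNIV. y j) = y k + (\<Sum>j\<in>UNIV-{k}. y j)"
    by (rule sum.remove) auto
  also have "(\<Sum>j\<in>UNIV-{k}. y j) = (\<Sum>j\<in>UNIV-{k}. s j)"
    by (intro sum.cong) (auto simp: y_def)
  finally have "(\<Sum>j\<in>UNIV. y j) < C" by (simp add: y_def)
  moreover have "absv (v $ j) \<le> real CARD('k) powi (y j)" for j
    using k by (cases "v $ j = 0") (auto simp: absv_nonzero y_def s_def powi_card_le_iff)
  ultimately show ?thesis using that[of y] by blast
qed

section \<open>The split orders\<close>

text \<open>The numbers \<open>\<alpha> j\<close> are the roots of \<open>\<Prod>\<^sub>i (T - Q i) = 1\<close>, so the vectors \<open>\<eta> i\<close> are units of the order
  generated by \<open>\<alpha>\<close>, embedded in the completion by its \<open>d\<close> places at infinity.  The columns of \<open>basis\<close>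
  are the Newton basis of this order for the nodes \<open>Q\<close>.\<close>

locale split_order =
  fixes ix :: "'d::finite \<Rightarrow> nat" and R \<alpha> :: "'d \<Rightarrow> 'k::{finite,field} fls"
  assumes ix: "bij_betw ix UNIV {..<CARD('d)}"
    and R: "\<And>i. R i \<in> poly_ring" and inj_R: "inj R"
    and root: "\<And>j. (\<Prod>i\<in>UNIV. \<alpha> j - fls_X_inv * R i) = 1"
    and close: "\<And>j. absv (\<alpha> j - fls_X_inv * R j) < 1"
begin

abbreviation Q :: "'d \<Rightarrow> 'k fls" where "Q i \<equiv> fls_X_inv * R i"

text \<open>The degree in \<open>x\<close> of \<open>Q i - Q j\<close>, serving as the weight of an
  edge in a complete graph.\<close>

definition n :: "'d \<Rightarrow> 'd \<Rightarrow> int" where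
  "n i j = (if i = j then 0 else - fls_subdegree (Q i - Q j))"

text \<open>The weighted degree of a vertex; also the degree in \<open>x\<close> of the derivative
  of \<open>\<Prod>i. (T - \<alpha> i)\<close> at \<open>\<alpha> j\<close>.\<close>

definition val :: "'d \<Rightarrow> int" where
  "val j = (\<Sum>i\<in>UNIV. n i j)"

text \<open>The total weight, each edge counted once; it becomes the logarithm of the covolume in
  \<open>absv_det_basis\<close>.\<close>

definition W :: int where
  "W = (\<Sum>j\<in>UNIV. \<Sum>i | ix i < ix j. n i j)"

text \<open>The components are the conjugates of one algebraic number; vectors multiply
  componentwise.\<close>

definition \<eta> :: "'d \<Rightarrow> 'k fls ^ 'd" where
  "\<eta> i = (\<chi> j. \<alpha> j - Q i)"

text \<open>Natural exponents also yield inverses: the product of all \<open>\<eta> i\<close> is 1,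
  so all exponents can be shifted together.\<close>

definition unit :: "('d \<Rightarrow> nat) \<Rightarrow> 'k fls ^ 'd" where
  "unit m = (\<Prod>i\<in>UNIV. \<eta> i ^ m i)"

definition newton :: "nat \<Rightarrow> 'k fls ^ 'd" where
  "newton p = (\<Prod>i | ix i < p. \<eta> i)"

definition basis :: "'k fls ^ 'd ^ 'd" where
  "basis = (\<chi> j k. newton (ix k) $ j)"

definition \<beta> :: "'k fls ^ 'd" where
  "\<beta> = (\<Sum>k\<in>UNIV. newton (ix k))"

section \<open>The weighted graph and the sizes of the units\<close>

lemma vec_prod_nth: "(\<Prod>i\<in>A. f i) $ j = (\<Prod>i\<in>A. f i $ j)" for f :: "'i \<Rightarrow> 'k fls ^ 'd"
  by (induction A rule: infinite_finite_induct) auto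

lemma vec_power_nth: "(f ^ m) $ j = (f $ j) ^ m" for f :: "'k fls ^ 'd"
  by (induction m) auto

lemma inj_ix: "ix i = ix j \<longleftrightarrow> i = j"
  using ix by (auto simp: bij_betw_def inj_def)

lemma ix_less: "ix i < CARD('d)"
  using ix by (auto simp: bij_betw_def)

lemma n_sym: "n i j = n j i"
  by (auto simp: n_def fls_subdegree_minus_sym)

lemma n_diag [simp]: "n i i = 0"
  by (simp add: n_def)

lemma absv_Q_diff: "i \<noteq> j \<Longrightarrow> absv (Q i - Q j) = real CARD('k) powi (n i j)"
  using inj_R by (subst absv_nonzero) (auto simp: n_def inj_def)

text \<open>Distinct polynomials differ by at least 1 in absolute value, and the factor
  \<open>x\<close> in \<open>Q\<close> adds one to the degree.\<close>

lemma n_pos: "1 \<le> n i j" if "i \<noteq> j"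
proof -
  have "R i - R j \<noteq> 0" using inj_R that by (auto simp: inj_def)
  then have "1 \<le> absv (R i - R j)" by (intro absv_poly_ring_ge_1 poly_ring_diff R)
  moreover have "Q i - Q j = fls_X_inv * (R i - R j)" by (simp add: right_diff_distrib)
  ultimately have "real CARD('k) powi 1 \<le> absv (Q i - Q j)"
    using mult_left_mono[of 1 "absv (R i - R j)" "real CARD('k)"] by (simp add: absv_mult)
  then show ?thesis
    using that powi_card_le_iff[where 'k='k] by (metis absv_Q_diff)
qed

lemma n_nonneg: "0 \<le> n i j"
  using n_pos[of i j] by (cases "i = j") auto

lemma double_W: "2 * W = (\<Sum>j\<in>UNIV. \<Sum>i\<in>UNIV. n i j)"
proof -
  have "(\<Sum>j\<in>UNIV. \<Sum>i\<in>UNIV. n i j)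
      = (\<Sum>j\<in>UNIV. \<Sum>i\<in>UNIV. (if ix i < ix j then n i j else 0) + (if ix j < ix i then n j i else 0))"
  proof (intro sum.cong refl)
    fix i j
    show "n i j = (if ix i < ix j then n i j else 0) + (if ix j < ix i then n j i else 0)"
      using n_sym[of i j] inj_ix[of i j] by auto
  qed
  also have "\<dots> = W + (\<Sum>j\<in>UNIV. \<Sum>i\<in>UNIV. if ix j < ix i then n j i else 0)"
    by (simp add: sum.distrib W_def sum.If_cases)
  also have "(\<Sum>j\<in>UNIV. \<Sum>i\<in>UNIV. if ix j < ix i then n j i else 0)
      = (\<Sum>i\<in>UNIV. \<Sum>j\<in>UNIV. if ix j < ix i then n j i else 0)"
    by (rule sum.swap)
  also have "\<dots> = W" by (simp add: W_def sum.If_cases)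
  finally show ?thesis by simp
qed

text \<open>As \<open>\<alpha> j\<close> is closer than 1 to \<open>Q j\<close>, while
  \<open>Q j - Q i\<close> is larger than 1, the ultrametric inequality allows replacing
  \<open>\<alpha> j\<close> by \<open>Q j\<close>.\<close>

lemma absv_eta_off: "i \<noteq> j \<Longrightarrow> absv (\<eta> i $ j) = real CARD('k) powi (n i j)"
proof -
  assume "i \<noteq> j"
  then have "absv (Q j - Q i) = real CARD('k) powi (n i j)" "real CARD('k) powi 0 < real CARD('k) powi (n i j)"
    using absv_Q_diff[of j i] n_sym n_pos[of i j] powi_card_less_iff[where 'k='k, of 0 "n i j"] by auto
  then have "absv ((Q j - Q i) + (\<alpha> j - Q j)) = real CARD('k) powi (n i j)"
    using close[of j] by (subst absv_add_eq) auto
  then show ?thesis by (simp add: \<eta>_def)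
qed

lemma prod_eta: "(\<Prod>i\<in>UNIV. \<eta> i) = 1"
  by (simp add: vec_eq_iff vec_prod_nth \<eta>_def root)

text \<open>The product of all \<open>\<eta> i $ j\<close> is 1, so the other factors determine this
  one.\<close>

lemma absv_eta_diag: "absv (\<eta> j $ j) = real CARD('k) powi (- val j)"
proof -
  have "1 = absv (\<Prod>i\<in>UNIV. \<eta> i $ j)"
    using arg_cong[OF prod_eta, of "\<lambda>v. v $ j"] by (simp add: vec_prod_nth)
  also have "\<dots> = absv (\<eta> j $ j) * (\<Prod>i\<in>UNIV-{j}. absv (\<eta> i $ j))"
    unfolding absv_prod by (rule prod.remove) auto
  also have "(\<Prod>i\<in>UNIV-{j}. absv (\<eta> i $ j)) = (\<Prod>i\<in>UNIV-{j}. real CARD('k) powi (n i j))"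
    by (intro prod.cong) (auto simp: absv_eta_off)
  also have "\<dots> = real CARD('k) powi (\<Sum>i\<in>UNIV-{j}. n i j)"
    by (simp add: prod_powi_card)
  also have "(\<Sum>i\<in>UNIV-{j}. n i j) = val j"
    by (simp add: val_def sum.remove[of _ j])
  finally show ?thesis
    by (simp add: power_int_minus field_simps)
qed

lemma eta_nz: "\<eta> i $ j \<noteq> 0"
  using absv_eta_diag[of j] absv_eta_off[of i j] card_field_ge_2[where 'k='k]
  by (cases "i = j") (metis absv_eq_0_iff not_numeral_le_zero power_int_eq_0_iff)+

text \<open>The exponent is, up to sign, the graph Laplacian applied to \<open>m\<close>:
  multiplication by units is chip firing.\<close>

lemma absv_unit: "absv (unit m $ j) = real CARD('k) powi (\<Sum>i\<in>UNIV. n i j * (int (m i) - int (m j)))"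
proof -
  have "absv (unit m $ j) = (\<Prod>i\<in>UNIV. absv (\<eta> i $ j) ^ m i)"
    by (simp add: unit_def vec_prod_nth vec_power_nth absv_prod absv_power)
  also have "\<dots> = absv (\<eta> j $ j) ^ m j * (\<Prod>i\<in>UNIV-{j}. absv (\<eta> i $ j) ^ m i)"
    by (rule prod.remove) auto
  also have "(\<Prod>i\<in>UNIV-{j}. absv (\<eta> i $ j) ^ m i) = (\<Prod>i\<in>UNIV-{j}. real CARD('k) powi (n i j * int (m i)))"
    by (intro prod.cong) (auto simp: absv_eta_off power_int_mult)
  also have "\<dots> = real CARD('k) powi (\<Sum>i\<in>UNIV-{j}. n i j * int (m i))"
    by (simp add: prod_powi_card)
  also have "(\<Sum>i\<in>UNIV-{j}. n i j * int (m i)) = (\<Sum>i\<in>UNIV. n i j * int (m i))"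
    by (simp add: sum.remove[of _ j])
  also have "absv (\<eta> j $ j) ^ m j = real CARD('k) powi (- (\<Sum>i\<in>UNIV. n i j * int (m j)))"
    unfolding absv_eta_diag val_def sum_distrib_right[symmetric]
    by (metis minus_mult_left power_int_mult power_int_of_nat)
  also have "\<dots> * real CARD('k) powi (\<Sum>i\<in>UNIV. n i j * int (m i))
      = real CARD('k) powi (\<Sum>i\<in>UNIV. n i j * (int (m i) - int (m j)))"
    by (simp add: right_diff_distrib sum_subtractf flip: power_int_add)
  finally show ?thesis .
qed

lemma unit_nz: "unit m $ j \<noteq> 0"
  by (simp add: unit_def vec_prod_nth vec_power_nth eta_nz)

text \<open>Stated for any set \<open>S\<close>, because it serves both the lattice and the class of
  \<open>\<beta>\<close> modulo \<open>x\<close>.\<close>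

lemma unit_mult_mem:
  assumes "\<And>i v. v \<in> S \<Longrightarrow> \<eta> i * v \<in> S" and "v \<in> S"
  shows "unit m * v \<in> S"
proof -
  have pow: "\<eta> i ^ k * v \<in> S" if "v \<in> S" for i k v
    using that by (induction k) (auto simp: mult.assoc intro: assms(1))
  have "(\<Prod>i\<in>A. \<eta> i ^ m i) * v \<in> S" for A
    using \<open>v \<in> S\<close>
    by (induction A rule: infinite_finite_induct) (auto simp: mult.assoc intro: pow)
  then show ?thesis by (simp add: unit_def)
qed

section \<open>The Newton basis as a module over the units\<close>

lemma newton_0: "newton 0 = 1"
  by (simp add: newton_def)

lemma newton_card: "newton CARD('d) = 1"
  using prod_eta by (simp add: newton_def ix_less)

lemma newton_Suc: "newton (Suc (ix k)) = \<eta> k * newton (ix k)"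
proof -
  have "{i. ix i < Suc (ix k)} = insert k {i. ix i < ix k}"
    using inj_ix by (auto simp: less_Suc_eq)
  then show ?thesis by (simp add: newton_def)
qed

lemma basis_mult: "basis *v u = (\<Sum>k\<in>UNIV. u $ k *s newton (ix k))"
  by (simp add: basis_def matrix_vector_mult_def vec_eq_iff mult.commute)

lemma newton_in_lattice: "newton (ix k) \<in> lattice_of basis"
  unfolding lattice_of_iff basis_mult
  by (intro exI[of _ "axis k 1"])
    (auto simp: axis_def poly_ring_0 poly_ring_1 vec_eq_iff if_distrib[of "\<lambda>x. x * _"] cong: if_cong)

text \<open>After the last index the product closes up to 1, which is the basis element of index 0.
  Here the equation for \<open>\<alpha>\<close> makes the lattice stable under
  multiplication.\<close>

lemma newton_Suc_in_lattice: "newton (Suc (ix k)) \<in> lattice_of basis"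
proof (cases "Suc (ix k) = CARD('d)")
  case True
  obtain k0 where "ix k0 = 0"
    using ix ix_less[of k] by (metis bij_betw_iff_bijections lessThan_iff zero_less_card_finite)
  then show ?thesis using newton_in_lattice[of k0] True by (simp add: newton_0 newton_card)
next
  case False
  then have "Suc (ix k) < CARD('d)" using ix_less[of k] by simp
  then obtain k' where "ix k' = Suc (ix k)"
    using ix by (metis bij_betw_iff_bijections lessThan_iff)
  then show ?thesis using newton_in_lattice[of k'] by simp
qed

text \<open>Split \<open>\<eta> i\<close> as \<open>\<eta> k\<close> plus the constant
  \<open>Q k - Q i\<close>.\<close>

lemma eta_mult_newton: "\<eta> i * newton (ix k) = newton (Suc (ix k)) + (Q k - Q i) *s newton (ix k)"
  unfolding newton_Suc by (simp add: vec_eq_iff \<eta>_def algebra_simps)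

lemma Q_in_poly_ring: "Q i \<in> poly_ring"
  by (intro poly_ring_mult fls_X_inv_in_poly_ring R)

lemma smult_mult_right: "v * (c *s w) = c *s (v * w)" for v w :: "'k fls ^ 'd"
  by (simp add: vec_eq_iff)

lemma eta_mult_lattice: "v \<in> lattice_of basis \<Longrightarrow> \<eta> i * v \<in> lattice_of basis"
proof -
  assume "v \<in> lattice_of basis"
  then obtain u where u: "\<forall>i. u $ i \<in> poly_ring" "v = (\<Sum>k\<in>UNIV. u $ k *s newton (ix k))"
    by (auto simp: lattice_of_iff basis_mult)
  have "\<eta> i * v = (\<Sum>k\<in>UNIV. u $ k *s (newton (Suc (ix k)) + (Q k - Q i) *s newton (ix k)))"
    by (simp only: u(2) sum_distrib_left smult_mult_right eta_mult_newton)
  also have "\<dots> \<in> lattice_of basis"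
    using u(1)
    by (intro lattice_of_sum lattice_of_smult lattice_of_add newton_in_lattice
        newton_Suc_in_lattice poly_ring_diff Q_in_poly_ring) auto
  finally show ?thesis .
qed

lemma unit_mult_lattice: "(\<lambda>v. unit m * v) ` lattice_of basis = lattice_of basis"
proof (intro subset_antisym subsetI)
  fix v assume "v \<in> (\<lambda>v. unit m * v) ` lattice_of basis"
  then show "v \<in> lattice_of basis"
    using unit_mult_mem[of "lattice_of basis"] eta_mult_lattice by auto
next
  fix v assume v: "v \<in> lattice_of basis"
  \<comment> \<open>The exponents \<open>M - m i\<close> give the inverse unit: together all
    exponents equal \<open>M\<close>, and the product of all \<open>\<eta> i\<close> is 1.\<close>
  define M where "M = (\<Sum>i\<in>UNIV. m i)"
  let ?m = "\<lambda>i. M - m i"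
  have le: "m i \<le> M" for i unfolding M_def by (rule member_le_sum) auto
  have "unit m * unit ?m = (\<Prod>i\<in>UNIV. \<eta> i ^ M)"
    using le by (simp add: unit_def flip: prod.distrib power_add)
  also have "\<dots> = 1" by (simp add: prod_power_distrib[symmetric] prod_eta)
  finally have "v = unit m * (unit ?m * v)" by (simp flip: mult.assoc)
  moreover have "unit ?m * v \<in> lattice_of basis"
    using unit_mult_mem[of "lattice_of basis"] eta_mult_lattice v by auto
  ultimately show "v \<in> (\<lambda>v. unit m * v) ` lattice_of basis" by blast
qed

text \<open>Modulo \<open>x\<close> the algebra is \<open>F\<^sub>q[T]/(T\<^sup>d - 1)\<close>, each \<open>\<eta> i\<close> becomes \<open>T\<close>, and \<open>\<beta>\<close> becomes
  \<open>1 + T + \<dots> + T\<^sup>d\<^sup>-\<^sup>1\<close>, which is fixed by multiplication with \<open>T\<close>.\<close>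

lemma eta_mult_beta:
  obtains w where "w \<in> lattice_of basis" "\<eta> i * \<beta> = \<beta> - fls_X_inv *s w"
proof
  let ?w = "\<Sum>k\<in>UNIV. (R i - R k) *s newton (ix k)"
  show "?w \<in> lattice_of basis"
    by (intro lattice_of_sum lattice_of_smult newton_in_lattice poly_ring_diff R)
  \<comment> \<open>The index shift permutes the Newton basis cyclically and so preserves its
    sum.\<close>
  have "(\<Sum>k\<in>UNIV. newton (Suc (ix k))) = (\<Sum>p<CARD('d). newton (Suc p))"
    by (rule sum.reindex_bij_betw[OF ix])
  also have "\<dots> = (\<Sum>p<CARD('d). newton p)"
    using sum.lessThan_Suc_shift[of newton "CARD('d)"] by (simp add: newton_0 newton_card)
  also have "\<dots> = \<beta>"
    unfolding \<beta>_def by (rule sum.reindex_bij_betw[OF ix, symmetric])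
  finally have shift: "(\<Sum>k\<in>UNIV. newton (Suc (ix k))) = \<beta>" .
  have "\<eta> i * \<beta> = (\<Sum>k\<in>UNIV. newton (Suc (ix k)) + (Q k - Q i) *s newton (ix k))"
    by (simp only: \<beta>_def sum_distrib_left eta_mult_newton)
  also have "\<dots> = \<beta> + (\<Sum>k\<in>UNIV. (Q k - Q i) *s newton (ix k))"
    by (simp only: sum.distrib shift)
  also have "(\<Sum>k\<in>UNIV. (Q k - Q i) *s newton (ix k)) = - (fls_X_inv *s ?w)"
    by (simp add: vec_eq_iff sum_distrib_left algebra_simps sum_subtractf)
  finally show "\<eta> i * \<beta> = \<beta> - fls_X_inv *s ?w" by simp
qed

lemma unit_mult_beta_class:
  assumes "w \<in> lattice_of basis"
  obtains w' where "w' \<in> lattice_of basis"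
    "unit m * (\<beta> - fls_X_inv *s w) = \<beta> - fls_X_inv *s w'"
proof -
  let ?S = "{\<beta> - fls_X_inv *s w | w. w \<in> lattice_of basis}"
  have "\<eta> i * v \<in> ?S" if v: "v \<in> ?S" for i v
  proof -
    obtain w where w: "w \<in> lattice_of basis" "v = \<beta> - fls_X_inv *s w" using v by blast
    obtain w0 where w0: "w0 \<in> lattice_of basis" "\<eta> i * \<beta> = \<beta> - fls_X_inv *s w0"
      by (rule eta_mult_beta)
    have "\<eta> i * v = \<beta> - fls_X_inv *s (w0 + \<eta> i * w)"
      by (simp add: w(2) w0(2) right_diff_distrib smult_mult_right vec.scale_right_distrib)
    moreover have "w0 + \<eta> i * w \<in> lattice_of basis"
      using w w0 by (intro lattice_of_add eta_mult_lattice)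
    ultimately show ?thesis by blast
  qed
  then have "unit m * (\<beta> - fls_X_inv *s w) \<in> ?S"
    by (rule unit_mult_mem) (use assms in auto)
  then show ?thesis using that by blast
qed

section \<open>The lower bound for \<open>mu\<close>\<close>

lemma absv_alpha_diff: "i \<noteq> j \<Longrightarrow> absv (\<alpha> j - \<alpha> i) = real CARD('k) powi (n i j)"
proof -
  assume ij: "i \<noteq> j"
  have "1 < real CARD('k) powi (n i j)"
    using n_pos[OF ij] powi_card_less_iff[where 'k='k, of 0 "n i j"] by simp
  then have "absv ((\<alpha> j - Q i) + - (\<alpha> i - Q i)) = absv (\<alpha> j - Q i)"
    using absv_eta_off[OF ij] close[of i] by (intro absv_add_eq) (simp add: \<eta>_def absv_minus_commute)
  then show ?thesis using absv_eta_off[OF ij] by (simp add: \<eta>_def)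
qed

lemma inj_alpha: "inj \<alpha>"
proof (rule injI, rule ccontr)
  fix i j assume "\<alpha> i = \<alpha> j" "i \<noteq> j"
  then have "real CARD('k) powi (n i j) = 0" using absv_alpha_diff[of i j] by simp
  then show False using card_field_ge_2[where 'k='k] by simp
qed

text \<open>The vector lists the values at the \<open>\<alpha> j\<close> of a polynomial
  \<open>P\<close> in Newton form. Its last Newton coefficient is the coefficient of degree
  \<open>CARD('d) - 1\<close>, which interpolation computes.\<close>

lemma leading_coordinate:
  assumes l: "Suc (ix l) = CARD('d)"
  shows "u $ l = (\<Sum>j\<in>UNIV. (basis *v u) $ j / (\<Prod>i\<in>UNIV-{j}. \<alpha> j - \<alpha> i))"
proof -
  let ?e = "\<lambda>k. \<Prod>i | ix i < ix k. [:- Q i, 1:]"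
  define P where "P = (\<Sum>k\<in>UNIV. smult (u $ k) (?e k))"
  have card: "card {i. ix i < ix k} = ix k" for k
  proof -
    have "ix ` {i. ix i < ix k} = {..<ix k}"
    proof (intro subset_antisym subsetI)
      fix p assume p: "p \<in> {..<ix k}"
      then have "p \<in> ix ` UNIV" using ix ix_less[of k] by (simp add: bij_betw_def)
      then show "p \<in> ix ` {i. ix i < ix k}" using p by auto
    qed auto
    moreover have "inj_on ix {i. ix i < ix k}" using inj_ix by (auto intro: inj_onI)
    ultimately show ?thesis by (metis card_image card_lessThan)
  qed
  have deg: "degree (?e k) = ix k" for k
    using coeff_prod_monic_linear(1)[of "{i. ix i < ix k}" Q] by (simp add: card)
  have "degree P \<le> CARD('d) - 1"
    unfolding P_def
    by (intro degree_sum_le order.trans[OF degree_smult_le]) (use deg ix_less in \<open>auto simp: Suc_leI le_diff_conv2 less_eq_Suc_le\<close>)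
  then have "degree P < CARD('d)" using l by simp
  then have "coeff P (CARD('d) - 1) = (\<Sum>j\<in>UNIV. poly P (\<alpha> j) / (\<Prod>i\<in>UNIV-{j}. \<alpha> j - \<alpha> i))"
    by (rule lagrange_leading_coeff[OF inj_alpha])
  moreover have "poly P (\<alpha> j) = (basis *v u) $ j" for j
    by (simp add: P_def poly_sum poly_prod basis_mult newton_def vec_prod_nth \<eta>_def)
  moreover have "coeff P (CARD('d) - 1) = u $ l"
  proof -
    have L: "CARD('d) - 1 = ix l" using l by simp
    have "coeff (?e k) (ix l) = (if k = l then 1 else 0)" for k
    proof (cases "k = l")
      case True
      then show ?thesis
        using coeff_prod_monic_linear(2)[of "{i. ix i < ix l}" Q] by (simp add: card)
    next
      case False
      then have "degree (?e k) < ix l"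
        unfolding deg using ix_less[of k] l inj_ix[of k l] by linarith
      then show ?thesis using False by (simp add: coeff_eq_0)
    qed
    then show ?thesis unfolding L by (simp add: P_def coeff_sum mult_delta_right)
  qed
  ultimately show ?thesis by simp
qed

text \<open>A unit spreads the shortness of \<open>v\<close> over all components, by
  \<open>firing_bound\<close>. The case \<open>C = W\<close> serves the lower bound for
  \<open>mu\<close>; another \<open>C\<close> bounds the norms of lattice vectors from
  below.\<close>

lemma short_vector_balanced:
  assumes "Nprod v < real CARD('k) powi C"
  obtains m z where "\<And>j. absv ((unit m * v) $ j) \<le> real CARD('k) powi (z j)"
    "\<And>j. int CARD('d) * z j < int CARD('d) * val j - (W - C)"
proof -
  obtain y where y: "\<And>j. absv (v $ j) \<le> real CARD('k) powi (y j)" "(\<Sum>j\<in>UNIV. y j) < C"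
    using Nprod_less_powi[OF assms] by blast
  obtain m where m: "\<And>j. int CARD('d) * (y j + (\<Sum>i\<in>UNIV. n i j * (int (m i) - int (m j))))
       \<le> int CARD('d) * (\<Sum>i\<in>UNIV. n i j) - (W - (\<Sum>i\<in>UNIV. y i))"
    using firing_bound[of n W y] n_sym n_diag n_pos double_W by blast
  let ?z = "\<lambda>j. y j + (\<Sum>i\<in>UNIV. n i j * (int (m i) - int (m j)))"
  show ?thesis
  proof (rule that)
    fix j
    have "absv ((unit m * v) $ j) = absv (unit m $ j) * absv (v $ j)"
      by (simp add: absv_mult)
    also have "\<dots> \<le> real CARD('k) powi (\<Sum>i\<in>UNIV. n i j * (int (m i) - int (m j)))
        * real CARD('k) powi (y j)"
      unfolding absv_unit using y(1)[of j] by (intro mult_left_mono) auto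
    also have "\<dots> = real CARD('k) powi ?z j" by (simp add: add.commute flip: power_int_add)
    finally show "absv ((unit m * v) $ j) \<le> real CARD('k) powi ?z j" .
    show "int CARD('d) * ?z j < int CARD('d) * val j - (W - C)"
      using m[of j] y(2) unfolding val_def by linarith
  qed
qed

text \<open>A short vector of the form \<open>\<beta> - x w\<close> can be moved by a unit to a vector whose leading coordinate
  has absolute value less than 1; but this coordinate is congruent to 1 modulo \<open>x\<close>.\<close>

lemma Nprod_beta_class_ge:
  assumes "w \<in> lattice_of basis"
  shows "real CARD('k) powi W \<le> Nprod (\<beta> - fls_X_inv *s w)"
proof (rule ccontr)
  assume "\<not> ?thesis"
  then obtain m z
    where z: "\<And>j. absv ((unit m * (\<beta> - fls_X_inv *s w)) $ j) \<le> real CARD('k) powi (z j)"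
      "\<And>j. int CARD('d) * z j < int CARD('d) * val j - (W - W)"
    using short_vector_balanced[of "\<beta> - fls_X_inv *s w" W] by (auto simp: not_le)
  obtain w' where w': "w' \<in> lattice_of basis"
    "unit m * (\<beta> - fls_X_inv *s w) = \<beta> - fls_X_inv *s w'"
    using unit_mult_beta_class[OF assms] .
  let ?v = "\<beta> - fls_X_inv *s w'"
  have small: "absv (?v $ j) < real CARD('k) powi (val j)" for j
  proof -
    have "z j < val j" using z(2)[of j] by simp
    then show ?thesis
      using z(1)[of j] powi_card_less_iff[where 'k='k] unfolding w'(2) by (metis le_less_trans)
  qed
  obtain r where r: "\<forall>i. r $ i \<in> poly_ring" "w' = basis *v r"
    using w' by (auto simp: lattice_of_iff)
  have v: "?v = basis *v (1 - fls_X_inv *s r)"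
    by (simp add: r(2) \<beta>_def basis_mult vec_eq_iff algebra_simps sum_subtractf sum_distrib_left)
  obtain l where l: "Suc (ix l) = CARD('d)"
  proof -
    have "CARD('d) - 1 \<in> ix ` UNIV" using ix by (simp add: bij_betw_def)
    then obtain l where "ix l = CARD('d) - 1" by auto
    then show ?thesis using that[of l] ix_less[of l] by simp
  qed
  have "absv (?v $ j / (\<Prod>i\<in>UNIV-{j}. \<alpha> j - \<alpha> i)) < 1" for j
  proof -
    have "absv (\<Prod>i\<in>UNIV-{j}. \<alpha> j - \<alpha> i) = (\<Prod>i\<in>UNIV-{j}. real CARD('k) powi (n i j))"
      unfolding absv_prod by (intro prod.cong) (auto simp: absv_alpha_diff)
    also have "\<dots> = real CARD('k) powi (\<Sum>i\<in>UNIV-{j}. n i j)"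
      by (simp add: prod_powi_card)
    also have "(\<Sum>i\<in>UNIV-{j}. n i j) = val j"
      by (simp add: val_def sum.remove[of _ j])
    finally have "absv (?v $ j / (\<Prod>i\<in>UNIV-{j}. \<alpha> j - \<alpha> i)) = absv (?v $ j) / real CARD('k) powi (val j)"
      by (simp only: divide_inverse absv_mult absv_inverse)
    also have "\<dots> < 1" using small[of j] by (simp add: divide_less_eq)
    finally show ?thesis .
  qed
  then have "absv ((1 - fls_X_inv *s r) $ l) < 1"
    unfolding leading_coordinate[OF l, of "1 - fls_X_inv *s r"] v[symmetric]
    by (intro absv_sum_less) auto
  moreover have "(1 - fls_X_inv *s r) $ l \<in> poly_ring"
    using r(1) by (auto intro!: poly_ring_diff poly_ring_1 poly_ring_mult fls_X_inv_in_poly_ring)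
  ultimately have "1 - fls_X_inv * (r $ l) = 0"
    using absv_poly_ring_ge_1[of "(1 - fls_X_inv *s r) $ l"] by fastforce
  \<comment> \<open>But this constant term is 1, as the polynomial \<open>r $ l\<close> has no term
    in \<open>1/x\<close>.\<close>
  then have "(1 - fls_X_inv * (r $ l)) $$ 0 = 0" by simp
  moreover have "(r $ l) $$ 1 = 0" using r(1) by (simp add: poly_ring_iff)
  ultimately show False by (simp add: fls_X_inv_times_conv_shift)
qed

section \<open>Sizes of the Newton basis, and the value of \<open>mu\<close>\<close>

lemma newton_nth: "newton p $ j = (\<Prod>i | ix i < p. \<eta> i $ j)"
  by (simp add: newton_def vec_prod_nth)

lemma absv_newton_below:
  assumes "p \<le> ix j"
  shows "absv (newton p $ j) = real CARD('k) powi (\<Sum>i | ix i < p. n i j)"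
proof -
  have "absv (newton p $ j) = (\<Prod>i | ix i < p. real CARD('k) powi (n i j))"
    unfolding newton_nth absv_prod using assms by (intro prod.cong refl absv_eta_off) auto
  then show ?thesis by (simp add: prod_powi_card)
qed

text \<open>The complementary product is the inverse of this one. It is nonempty, and all its
  factors are larger than 1 because it omits \<open>\<eta> j\<close>.\<close>

lemma absv_newton_above:
  assumes "ix j < p" "p < CARD('d)"
  shows "absv (newton p $ j) < 1"
proof -
  let ?s = "\<Sum>i | \<not> ix i < p. n i j"
  have "(\<Prod>i | ix i < p. \<eta> i $ j) * (\<Prod>i | \<not> ix i < p. \<eta> i $ j) = (\<Prod>i\<in>UNIV. \<eta> i $ j)"
    by (subst prod.union_disjoint[symmetric]) (auto intro: prod.cong)
  also have "\<dots> = 1"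
    using arg_cong[OF prod_eta, of "\<lambda>v. v $ j"] by (simp add: vec_prod_nth)
  finally have "absv (newton p $ j) * absv (\<Prod>i | \<not> ix i < p. \<eta> i $ j) = 1"
    by (metis absv_1 absv_mult newton_nth)
  moreover have "absv (\<Prod>i | \<not> ix i < p. \<eta> i $ j) = (\<Prod>i | \<not> ix i < p. real CARD('k) powi (n i j))"
    unfolding absv_prod using assms by (intro prod.cong refl absv_eta_off) auto
  ultimately have eq: "absv (newton p $ j) * real CARD('k) powi ?s = 1"
    by (simp add: prod_powi_card)
  obtain k where k: "ix k = p"
    using ix assms by (metis bij_betw_iff_bijections lessThan_iff)
  have "1 \<le> n k j" using k assms by (intro n_pos) auto
  also have "n k j \<le> ?s" using k n_nonneg by (intro member_le_sum) auto
  finally have "real CARD('k) powi ?s > 1"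
    using powi_card_less_iff[where 'k='k, of 0 ?s] by simp
  then show ?thesis
    using eq absv_nonneg[of "newton p $ j"]
    by (smt (verit) mult_le_cancel_left1 mult_cancel_left1)
qed

lemma absv_basis_diag:
  "absv (basis $ j $ j) = real CARD('k) powi (\<Sum>i | ix i < ix j. n i j)"
  by (simp add: basis_def absv_newton_below)

lemma basis_diag_nz: "basis $ j $ j \<noteq> 0"
  by (simp add: basis_def newton_nth eta_nz)

text \<open>In the order of \<open>ix\<close>, an entry before the diagonal lacks at least the
  factor \<open>\<eta> j $ i\<close>, which is larger than 1; an entry after it is smaller than
  1.\<close>

lemma basis_dominant: "absv (basis $ i $ j) < absv (basis $ i $ i)" if "i \<noteq> j"
proof (cases "ix j < ix i")
  case True
  have "(\<Sum>k | ix k < ix j. n k i) < (\<Sum>k | ix k < ix i. n k i)"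
    using True n_pos[of j i] that n_nonneg by (intro sum_strict_mono2[of _ _ j]) auto
  then show ?thesis
    using True by (simp add: absv_basis_diag powi_card_less_iff) (simp add: basis_def absv_newton_below powi_card_less_iff)
next
  case False
  then have "ix i < ix j" using inj_ix[of i j] that by auto
  then have "absv (basis $ i $ j) < 1"
    using absv_newton_above[of i "ix j"] ix_less by (simp add: basis_def)
  also have "1 \<le> absv (basis $ i $ i)"
    using powi_card_le_iff[where 'k='k, of 0] by (simp add: absv_basis_diag sum_nonneg n_nonneg)
  finally show ?thesis .
qed

lemma absv_det_basis: "absv (det basis) = real CARD('k) powi W"
  using absv_det_row_dominant[of basis] basis_dominant basis_diag_nz
  by (simp add: absv_basis_diag prod_powi_card W_def)

lemma basis_in_GL: "basis \<in> GL"
proof -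
  have "absv (det basis) \<noteq> 0"
    unfolding absv_det_basis using card_field_ge_2[where 'k='k] by simp
  then show ?thesis by (simp add: GL_def invertible_det_nz)
qed

text \<open>Coordinates are rounded with error at most \<open>1/q\<close>. By row dominance
  component \<open>i\<close> of the error is at most the diagonal entry over \<open>q\<close>, and
  the diagonal entries multiply to the covolume.\<close>

lemma ex_close_lattice_point:
  "\<exists>u\<in>lattice_of basis. Nprod (v - u) \<le> real CARD('k) powi (- int CARD('d)) * absv (det basis)"
proof -
  obtain c where c: "v = basis *v c"
  proof -
    obtain h where "basis ** h = mat 1" using basis_in_GL by (auto simp: GL_def invertible_def)
    then show ?thesis using that[of "h *v v"] by (simp add: matrix_vector_mul_assoc)
  qed
  have "\<exists>r\<in>poly_ring. absv (c $ i - r) \<le> 1 / real CARD('k)" for i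
    using poly_ring_approx[of "c $ i"] by blast
  then obtain r where r: "\<And>i. r i \<in> poly_ring" "\<And>i. absv (c $ i - r i) \<le> 1 / real CARD('k)"
    by metis
  let ?u = "basis *v (\<chi> i. r i)"
  have "absv ((v - ?u) $ i) \<le> absv (basis $ i $ i) / real CARD('k)" for i
  proof -
    have "(v - ?u) $ i = (\<Sum>j\<in>UNIV. basis $ i $ j * (c $ j - r j))"
      by (simp add: c matrix_vector_mult_def right_diff_distrib sum_subtractf)
    moreover have "absv (basis $ i $ j * (c $ j - r j)) \<le> absv (basis $ i $ i) * (1 / real CARD('k))" for j
      unfolding absv_mult
    proof (rule mult_mono)
      show "absv (basis $ i $ j) \<le> absv (basis $ i $ i)"
        using basis_dominant[of i j] by (cases "i = j") auto
    qed (use r(2) in auto)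
    ultimately show ?thesis by (auto intro!: absv_sum_le)
  qed
  then have "Nprod (v - ?u) \<le> (\<Prod>i\<in>UNIV. absv (basis $ i $ i) / real CARD('k))"
    unfolding Nprod_def by (intro prod_mono) auto
  also have "\<dots> = real CARD('k) powi (- int CARD('d)) * absv (det basis)"
    using absv_det_row_dominant[of basis] basis_dominant basis_diag_nz
    by (simp add: prod_dividef power_int_minus field_simps)
  finally show ?thesis
    using r(1) by (intro bexI[of _ ?u]) (auto simp: lattice_of_def)
qed

text \<open>The extremal vector is \<open>\<beta>\<close> divided by \<open>x\<close>, written
  \<open>fls_X *s \<beta>\<close>. Multiplying its difference from a lattice vector by
  \<open>x\<close> leads into the class treated in \<open>Nprod_beta_class_ge\<close>.\<close>

lemma mu_basis: "mu (lattice_of ` pgl_proj basis) = real CARD('k) powi (- int CARD('d))"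
proof (rule mu_lattice_class_eqI[OF basis_in_GL ex_close_lattice_point])
  fix u assume u: "u \<in> lattice_of basis"
  have "fls_X * fls_X_inv = (1 :: 'k fls)"
    by (metis fls_X_nonzero fls_inverse_X right_inverse)
  then have "fls_X *s \<beta> - u = (\<chi> i. fls_X) * (\<beta> - fls_X_inv *s u)"
    by (simp add: vec_eq_iff right_diff_distrib flip: mult.assoc)
  then have "Nprod (fls_X *s \<beta> - u) = Nprod ((\<chi> i. fls_X) :: 'k fls ^ 'd) * Nprod (\<beta> - fls_X_inv *s u)"
    by (simp only: Nprod_mult)
  also have "Nprod ((\<chi> i. fls_X) :: 'k fls ^ 'd) = real CARD('k) powi (- int CARD('d))"
    by (simp add: Nprod_def absv_nonzero power_int_minus power_inverse)
  also have "\<dots> * Nprod (\<beta> - fls_X_inv *s u) \<ge> real CARD('k) powi (- int CARD('d)) * absv (det basis)"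
    unfolding absv_det_basis using Nprod_beta_class_ge[OF u] by (intro mult_left_mono) auto
  finally show "real CARD('k) powi (- int CARD('d)) * absv (det basis) \<le> Nprod (fls_X *s \<beta> - u)" .
qed

section \<open>Compactness of the orbit\<close>

lemma subdegree_unit:
  "fls_subdegree (unit m $ j) = - (\<Sum>i\<in>UNIV. n i j * (int (m i) - int (m j)))"
proof -
  let ?s = "\<Sum>i\<in>UNIV. n i j * (int (m i) - int (m j))"
  have "real CARD('k) powi (- fls_subdegree (unit m $ j)) = real CARD('k) powi ?s"
    by (rule trans[OF absv_nonzero[OF unit_nz, symmetric] absv_unit])
  then have "- fls_subdegree (unit m $ j) = ?s"
    unfolding order_eq_iff powi_card_le_iff .
  then show ?thesis by simp
qed

text \<open>A homothety brings the sum of the exponents between 0 and \<open>?d - 1\<close>, and a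
  unit bounds each exponent from above. The unit keeps the sum, so the exponents are bounded from
  below too.\<close>

lemma unit_scaling_bounded:
  "\<exists>B. \<forall>t. (\<forall>j. t $ j \<noteq> 0) \<longrightarrow>
     (\<exists>c m. c \<noteq> 0 \<and> (\<forall>j. \<bar>fls_subdegree (c * t $ j * unit m $ j)\<bar> \<le> B))"
proof -
  let ?d = "int CARD('d)"
  have W: "0 \<le> W" unfolding W_def by (intro sum_nonneg n_nonneg)
  have val: "0 \<le> val j" for j unfolding val_def by (intro sum_nonneg n_nonneg)
  define V where "V = (\<Sum>j\<in>UNIV. val j) + 1"
  have V: "val j + 1 \<le> V" for j
    unfolding V_def using val by (auto intro!: member_le_sum)
  have "0 \<le> V" using val V by (meson add_nonneg_nonneg order.trans zero_le_one)
  have "\<exists>c m. c \<noteq> 0 \<and> (\<forall>j. \<bar>fls_subdegree (c * t $ j * unit m $ j)\<bar> \<le> ?d * V)"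
    if t: "\<forall>j. t $ j \<noteq> 0" for t :: "'k fls ^ 'd"
  proof -
    \<comment> \<open>With this quotient the sum of the \<open>y j\<close> is the remainder modulo
      \<open>?d\<close>.\<close>
    define s where "s = (\<Sum>j\<in>UNIV. - fls_subdegree (t $ j)) div ?d"
    define c :: "'k fls" where "c = fls_X_intpow s"
    define y where "y j = - fls_subdegree (t $ j) - s" for j
    have "(\<Sum>j\<in>UNIV. y j) = (\<Sum>j\<in>UNIV. - fls_subdegree (t $ j)) mod ?d"
      unfolding y_def sum_subtractf s_def by (simp add: minus_div_mult_eq_mod[symmetric] mult.commute)
    then have y: "0 \<le> (\<Sum>j\<in>UNIV. y j)" "(\<Sum>j\<in>UNIV. y j) < ?d" by simp_all
    obtain m where m: "\<And>j. ?d * (y j + (\<Sum>i\<in>UNIV. n i j * (int (m i) - int (m j))))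
       \<le> ?d * (\<Sum>i\<in>UNIV. n i j) - (W - (\<Sum>i\<in>UNIV. y i))"
      using firing_bound[of n W y] n_sym n_diag n_pos double_W by blast
    define z where "z j = y j + (\<Sum>i\<in>UNIV. n i j * (int (m i) - int (m j)))" for j
    have z: "fls_subdegree (c * t $ j * unit m $ j) = - z j" for j
      using t unit_nz[of m j] by (simp add: c_def z_def y_def subdegree_unit)
    have up: "z j \<le> V" for j
    proof -
      have "?d * z j \<le> ?d * val j - (W - (\<Sum>i\<in>UNIV. y i))"
        using m[of j] by (simp only: z_def val_def)
      then have "?d * z j < ?d * (val j + 1)"
        using W y(2) by (simp add: distrib_left)
      then have "z j < val j + 1" by (rule mult_left_less_imp_less) simp
      with V[of j] show ?thesis by simp
    qed
    \<comment> \<open>By symmetry of \<open>n\<close> the Laplacian of \<open>m\<close> sums to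
      0.\<close>
    have "(\<Sum>j\<in>UNIV. \<Sum>i\<in>UNIV. n i j * int (m i)) = (\<Sum>i\<in>UNIV. \<Sum>j\<in>UNIV. n i j * int (m i))"
      by (rule sum.swap)
    also have "\<dots> = (\<Sum>j\<in>UNIV. \<Sum>i\<in>UNIV. n i j * int (m j))"
      by (simp only: n_sym)
    finally have "(\<Sum>j\<in>UNIV. z j) = (\<Sum>j\<in>UNIV. y j)"
      by (simp add: z_def sum.distrib right_diff_distrib sum_subtractf)
    have "- z j \<le> ?d * V" for j
    proof -
      have "0 \<le> (\<Sum>i\<in>UNIV. z i)" using y(1) \<open>(\<Sum>j\<in>UNIV. z j) = (\<Sum>j\<in>UNIV. y j)\<close> by simp
      also have "\<dots> = z j + (\<Sum>i\<in>UNIV-{j}. z i)" by (rule sum.remove) auto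
      also have "(\<Sum>i\<in>UNIV-{j}. z i) \<le> (\<Sum>i\<in>UNIV-{j}. V)" by (intro sum_mono up)
      also have "\<dots> \<le> (\<Sum>i\<in>(UNIV::'d set). V)" using \<open>0 \<le> V\<close> by (intro sum_mono2) auto
      finally show ?thesis by simp
    qed
    moreover have "z j \<le> ?d * V" for j
    proof -
      have "1 * V \<le> ?d * V" using \<open>0 \<le> V\<close> by (intro mult_right_mono) (auto simp: Suc_leI)
      with up[of j] show ?thesis by simp
    qed
    ultimately have "\<bar>z j\<bar> \<le> ?d * V" for j by (simp add: abs_le_iff)
    moreover have "c \<noteq> 0" by (simp add: c_def)
    ultimately show ?thesis using z by (intro exI[of _ c] exI[of _ m]) auto
  qed
  then show ?thesis by blast
qed

text \<open>Up to homotheties and the units \<open>unit m\<close>, which stabilise the lattice, every diagonal matrix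
  lies in a compact set.\<close>

lemma compactin_orbit: "compactin lattice_space (diag_orbit (lattice_of ` pgl_proj basis))"
proof -
  obtain B where B: "\<forall>t. (\<forall>j. t $ j \<noteq> 0) \<longrightarrow>
      (\<exists>c m. c \<noteq> 0 \<and> (\<forall>j. \<bar>fls_subdegree (c * t $ j * unit m $ j)\<bar> \<le> B))"
    using unit_scaling_bounded by blast
  \<comment> \<open>The upper bounds make \<open>T\<close> bounded; the lower ones keep the entries
    nonzero, so that the matrices stay in \<open>GL\<close>.\<close>
  define T where "T = {t :: 'k fls ^ 'd. \<forall>j. 2 powi (- B) \<le> dist (t $ j) 0 \<and> dist (t $ j) 0 \<le> 2 powi B}"
  have "closed T"
    unfolding T_def by (intro closed_Collect_all closed_Collect_conj closed_Collect_le continuous_intros)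
  moreover have "bounded T"
    unfolding bounded_any_center[of _ 0]
  proof (intro exI ballI)
    fix t assume "t \<in> T"
    then have "(\<Sum>j\<in>UNIV. dist (0 $ j) (t $ j)) \<le> (\<Sum>j\<in>(UNIV::'d set). 2 powi B)"
      by (intro sum_mono) (auto simp: T_def dist_commute)
    then show "dist 0 t \<le> (\<Sum>j\<in>(UNIV::'d set). 2 powi B)"
      unfolding dist_vec_def using L2_set_le_sum[of UNIV "\<lambda>j. dist (0 $ j) (t $ j)"] by simp
  qed
  ultimately have "compact T" by (simp add: compact_eq_bounded_closed)
  have nz: "\<forall>j. t $ j \<noteq> 0" if "t \<in> T" for t
    using that unfolding T_def by (smt (verit, best) dist_self mem_Collect_eq zero_less_power_int)
  have "continuous_on T (\<lambda>t. diag_mat t ** basis)"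
    unfolding diag_mat_mult
    by (intro continuous_on_vec_lambda continuous_on_fls_mult_right continuous_intros)
  then have "compact ((\<lambda>t. diag_mat t ** basis) ` T)"
    using \<open>compact T\<close> by (rule compact_continuous_image)
  moreover have "(\<lambda>t. diag_mat t ** basis) ` T \<subseteq> GL"
    using nz basis_in_GL by (auto intro!: GL_mult simp: diag_mat_in_GL_iff)
  ultimately have "compactin (subtopology euclidean GL) ((\<lambda>t. diag_mat t ** basis) ` T)"
    by (simp add: compactin_subtopology)
  then have "compactin lattice_space ((\<lambda>h. lattice_of ` pgl_proj h) ` (\<lambda>t. diag_mat t ** basis) ` T)"
    using continuous_map_lattice_class by (rule image_compactin)
  moreover have "diag_orbit (lattice_of ` pgl_proj basis)
      = (\<lambda>h. lattice_of ` pgl_proj h) ` (\<lambda>t. diag_mat t ** basis) ` T" (is "?l = ?r")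
  proof (intro subset_antisym subsetI)
    fix x assume "x \<in> ?l"
    then obtain t where t: "\<forall>j. t $ j \<noteq> 0" and x: "x = lattice_of ` pgl_proj (diag_mat t ** basis)"
      unfolding diag_orbit_lattice_class by blast
    obtain c m where c: "c \<noteq> 0" and m: "\<And>j. \<bar>fls_subdegree (c * t $ j * unit m $ j)\<bar> \<le> B"
      using B t by blast
    \<comment> \<open>The homothety \<open>c\<close> and the unit move \<open>t\<close> into
      \<open>T\<close> without changing the class.\<close>
    let ?t = "(\<chi> i. c) * t * unit m"
    have "dist (?t $ j) 0 = 2 powi (- fls_subdegree (c * t $ j * unit m $ j))" for j
      using c t unit_nz[of m j] by (subst dist_fls_eq_powi) auto
    then have "?t \<in> T"
      unfolding T_def using m by (auto simp: powi_le_iff abs_le_iff)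
    have "lattice_of ` pgl_proj (diag_mat ?t ** basis)
        = lattice_of ` pgl_proj (mat c ** (diag_mat t ** (diag_mat (unit m) ** basis)))"
      by (simp only: mat_eq_diag_mat matrix_mul_assoc diag_mat_mult_diag_mat mult.assoc)
    also have "\<dots> = lattice_of ` pgl_proj (diag_mat t ** (diag_mat (unit m) ** basis))"
      by (rule lattice_class_scale[OF c])
    also have "\<dots> = x"
      unfolding x by (rule lattice_class_cong) (simp add: lattice_of_diag_mat_mult unit_mult_lattice)
    finally show "x \<in> ?r" using \<open>?t \<in> T\<close> by blast
  next
    fix x assume "x \<in> ?r"
    then show "x \<in> ?l"
      unfolding diag_orbit_lattice_class using nz by blast
  qed
  ultimately show ?thesis by simp
qed

section \<open>Invariants that separate the orbits\<close>

lemma one_in_lattice: "1 \<in> lattice_of basis"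
proof -
  obtain k0 where "ix k0 = 0"
    using ix by (metis bij_betw_iff_bijections lessThan_iff zero_less_card_finite)
  then show ?thesis using newton_in_lattice[of k0] by (simp add: newton_0)
qed

text \<open>A nonzero vector of too small norm could be balanced by a unit into a nonzero lattice
  vector with all components small, against discreteness.\<close>

lemma Nprod_lattice_bounded_below:
  "\<exists>C. \<forall>u\<in>lattice_of basis. u \<noteq> 0 \<longrightarrow> real CARD('k) powi C \<le> Nprod u"
proof -
  let ?d = "int CARD('d)"
  obtain B where B: "\<And>u. u \<in> lattice_of basis \<Longrightarrow>
      \<forall>j. absv (u $ j) \<le> real CARD('k) powi B \<Longrightarrow> u = 0"
    using lattice_of_discrete[OF basis_in_GL] by blast
  have val: "0 \<le> val j" for j unfolding val_def by (intro sum_nonneg n_nonneg)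
  \<comment> \<open>Chosen so that the bound of \<open>short_vector_balanced\<close> becomes
    \<open>?d * z j < ?d * B\<close>.\<close>
  let ?C = "W - ?d * (\<Sum>j\<in>UNIV. val j) + ?d * B"
  have "real CARD('k) powi ?C \<le> Nprod u" if u: "u \<in> lattice_of basis" "u \<noteq> 0" for u
  proof (rule ccontr)
    assume "\<not> ?thesis"
    then obtain m z where z: "\<And>j. absv ((unit m * u) $ j) \<le> real CARD('k) powi (z j)"
        "\<And>j. ?d * z j < ?d * val j - (W - ?C)"
      using short_vector_balanced[of u ?C] by (auto simp: not_le)
    have "absv ((unit m * u) $ j) \<le> real CARD('k) powi B" for j
    proof -
      have "?d * val j \<le> ?d * (\<Sum>j\<in>UNIV. val j)"
        using val by (intro mult_left_mono member_le_sum) auto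
      then have "?d * z j < ?d * B" using z(2)[of j] by linarith
      then have "z j \<le> B" by (simp add: mult_less_cancel_left)
      then show ?thesis using z(1)[of j] powi_card_le_iff[where 'k='k] by (metis order_trans)
    qed
    moreover have "unit m * u \<in> lattice_of basis" using u(1) unit_mult_lattice by blast
    ultimately have "unit m * u = 0" using B by blast
    then have "u = 0" using unit_nz[of m] by (simp add: vec_eq_iff)
    with u(2) show False by simp
  qed
  then show ?thesis by blast
qed

lemma n_le_W: "n i j \<le> W"
proof -
  have *: "n i j \<le> W" if "ix i < ix j" for i j
  proof -
    have "n i j \<le> (\<Sum>i | ix i < ix j. n i j)"
      using that n_nonneg by (intro member_le_sum) auto
    also have "\<dots> \<le> W"
      unfolding W_def
      using n_nonneg by (intro member_le_sum[of j UNIV "\<lambda>j. \<Sum>i | ix i < ix j. n i j"]) (auto intro: sum_nonneg)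
    finally show ?thesis .
  qed
  show ?thesis
  proof (cases "i = j")
    case True
    then show ?thesis unfolding W_def by (auto intro!: sum_nonneg n_nonneg)
  next
    case False
    then show ?thesis using *[of i j] *[of j i] n_sym[of i j] inj_ix[of i j] by force
  qed
qed

end

section \<open>Existence of split orders\<close>

lemma absv_less_1_iff_dist: "absv z < 1 \<longleftrightarrow> dist z 0 \<le> 2 powi (- 1)"
  for z :: "'k::{finite,field} fls"
  using absv_less_powi_iff[of z 0] by (simp only: power_int_0_right absv_le_powi_iff dist_fls_le_powi_iff) simp

text \<open>Banach's fixed point theorem for \<open>z \<mapsto> 1 / \<Prod>\<^sub>i (D i + z)\<close>.\<close>

lemma ex_small_root:
  fixes D :: "'i \<Rightarrow> 'k::{finite,field} fls"
  assumes fin: "finite A" and ne: "A \<noteq> {}" and D: "\<And>i. i \<in> A \<Longrightarrow> 1 < absv (D i)"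
  obtains z where "absv z < 1" "z * (\<Prod>i\<in>A. D i + z) = 1"
proof -
  define f where "f z = (\<Prod>i\<in>A. inverse (D i + z))" for z
  \<comment> \<open>This ball of the base 2 metric is the set \<open>absv z < 1\<close>.\<close>
  define S :: "'k fls set" where "S = {z. dist z 0 \<le> 2 powi (- 1)}"
  have S: "z \<in> S \<longleftrightarrow> absv z < 1" for z by (simp only: S_def absv_less_1_iff_dist mem_Collect_eq)
  have Dz: "absv (D i + z) = absv (D i)" if "i \<in> A" "z \<in> S" for i z
    using D that by (intro absv_add_eq) (auto simp: S intro: less_trans)
  have q: "real CARD('k) \<le> absv (D i)" if "i \<in> A" for i
    using D[OF that] absv_less_powi_iff[of "D i" 1] by (auto simp: not_less)
  have inv: "absv (inverse (D i + z)) \<le> 1 / real CARD('k)" if "i \<in> A" "z \<in> S" for i z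
    using q[OF that(1)] card_field_ge_2[where 'k='k]
    unfolding absv_inverse Dz[OF that] by (subst inverse_eq_divide) (intro frac_le, auto)
  have inv1: "absv (inverse (D i + z)) < 1" if "i \<in> A" "z \<in> S" for i z
  proof -
    have "1 / real CARD('k) < 1" using card_field_ge_2[where 'k='k] by simp
    with inv[OF that] show ?thesis by linarith
  qed
  have "\<exists>!z\<in>S. f z = z"
  proof (rule Banach_fix[where c = "1 / 2"])
    have "closed S" unfolding S_def by (intro closed_Collect_le continuous_intros)
    then show "complete S" by (simp add: complete_eq_closed)
    have "0 \<in> S" by (simp add: S)
    then show "S \<noteq> {}" by blast
    show "f ` S \<subseteq> S"
    proof safe
      fix z assume z: "z \<in> S"
      obtain a where a: "a \<in> A" using ne by blast
      have "absv (f z) = absv (inverse (D a + z)) * (\<Prod>i\<in>A-{a}. absv (inverse (D i + z)))"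
        unfolding f_def absv_prod using fin a by (rule prod.remove)
      also have "\<dots> \<le> absv (inverse (D a + z)) * 1"
        using inv1[OF _ z] by (intro mult_left_mono prod_le_1) (auto simp: less_imp_le)
      also have "\<dots> < 1" using inv1[OF a z] by simp
      finally show "f z \<in> S" by (simp add: S)
    qed
    fix x y assume xy: "x \<in> S" "y \<in> S"
    show "dist (f x) (f y) \<le> 1 / 2 * dist x y"
    proof (cases "x = y")
      case False
      define k where "k = - fls_subdegree (x - y)"
      have k: "absv (x - y) = real CARD('k) powi k" using False by (simp add: absv_nonzero k_def)
      have "absv (f x - f y) \<le> real CARD('k) powi (k - 1)"
        unfolding f_def
      proof (rule absv_prod_diff_le)
        fix i assume i: "i \<in> A"
        show "absv (inverse (D i + x)) \<le> 1" "absv (inverse (D i + y)) \<le> 1"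
          using inv1[OF i] xy by (auto simp: less_imp_le)
        have nz: "D i + x \<noteq> 0" "D i + y \<noteq> 0"
          using Dz[OF i] xy D[OF i] by (metis absv_0 not_one_less_zero)+
        have "inverse (D i + x) - inverse (D i + y) = (y - x) * (inverse (D i + x) * inverse (D i + y))"
          using nz by (simp add: field_simps)
        then have "absv (inverse (D i + x) - inverse (D i + y))
            = absv (x - y) * (absv (inverse (D i + x)) * absv (inverse (D i + y)))"
          by (simp only: absv_mult absv_minus_commute)
        also have "\<dots> \<le> absv (x - y) * (1 / real CARD('k) * 1)"
          using inv[OF i xy(1)] inv1[OF i xy(2)] by (intro mult_left_mono mult_mono) auto
        also have "\<dots> = real CARD('k) powi (k - 1)"
          by (simp add: k power_int_diff)
        finally show "absv (inverse (D i + x) - inverse (D i + y)) \<le> real CARD('k) powi (k - 1)" .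
      qed auto
      \<comment> \<open>Both metrics depend only on the subdegree, so a gain of one exponent in base
        \<open>q\<close> is a factor \<open>1/2\<close> here.\<close>
      then have "dist (f x) (f y) \<le> 2 powi (k - 1)"
        unfolding absv_le_powi_iff dist_fls_le_powi_iff by simp
      also have "\<dots> = 1 / 2 * dist x y"
        using False by (simp add: dist_fls_eq_powi k_def power_int_diff)
      finally show ?thesis .
    qed simp
  qed auto
  then obtain z where z: "z \<in> S" "f z = z" by blast
  have "D i + z \<noteq> 0" if "i \<in> A" for i
    using Dz[OF that z(1)] D[OF that] by (metis absv_0 not_one_less_zero)
  then have "f z * (\<Prod>i\<in>A. D i + z) = 1"
    unfolding f_def by (simp flip: prod.distrib)
  with z show ?thesis by (intro that[of z]) (simp_all add: S)
qed

text \<open>The root near \<open>Q j\<close> is \<open>Q j + z\<close> with \<open>z\<close> from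
  \<open>ex_small_root\<close>; as \<open>d\<close> is at least 2, other nodes exist and make
  \<open>z\<close> small.\<close>

lemma ex_split_order:
  fixes R :: "'d::finite \<Rightarrow> 'k::{finite,field} fls"
  assumes d: "CARD('d) \<ge> 2" and R: "\<And>i. R i \<in> poly_ring" and inj: "inj R"
    and ix: "bij_betw ix UNIV {..<CARD('d)}"
  obtains \<alpha> where "split_order ix R \<alpha>"
proof -
  let ?Q = "\<lambda>i. fls_X_inv * R i"
  have "\<exists>z. absv z < 1 \<and> z * (\<Prod>i\<in>UNIV-{j}. (?Q j - ?Q i) + z) = 1" for j
  proof -
    have "card (UNIV - {j}) \<noteq> 0" using d by simp
    then have "UNIV - {j} \<noteq> {}" by (metis card.empty)
    moreover have "1 < absv (?Q j - ?Q i)" if "i \<in> UNIV - {j}" for i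
    proof -
      have "R j - R i \<noteq> 0" using inj that by (auto simp: inj_def)
      then have "1 \<le> absv (R j - R i)" by (intro absv_poly_ring_ge_1 poly_ring_diff R)
      then have "1 < real CARD('k) * absv (R j - R i)"
        using card_field_ge_2[where 'k='k] mult_mono[of 2 "real CARD('k)" 1 "absv (R j - R i)"] by simp
      then show ?thesis by (simp add: absv_mult flip: right_diff_distrib)
    qed
    ultimately show ?thesis using ex_small_root[of "UNIV - {j}" "\<lambda>i. ?Q j - ?Q i"] by (metis finite)
  qed
  then obtain z where z: "\<And>j. absv (z j) < 1"
      "\<And>j. z j * (\<Prod>i\<in>UNIV-{j}. (?Q j - ?Q i) + z j) = 1"
    by metis
  have "split_order ix R (\<lambda>j. ?Q j + z j)"
  proof
    fix j
    have "(\<Prod>i\<in>UNIV. ?Q j + z j - ?Q i) = (?Q j + z j - ?Q j) * (\<Prod>i\<in>UNIV-{j}. ?Q j + z j - ?Q i)"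
      by (rule prod.remove) auto
    also have "\<dots> = 1" using z(2)[of j] by (simp add: algebra_simps)
    finally show "(\<Prod>i\<in>UNIV. ?Q j + z j - ?Q i) = 1" .
    show "absv (?Q j + z j - ?Q j) < 1" using z(1) by simp
  qed (use assms in auto)
  then show ?thesis by (rule that)
qed

section \<open>Infinitely many orbits\<close>

lemma ex_compact_orbit:
  assumes d: "CARD('d::finite) \<ge> 2"
  obtains g :: "'k::{finite,field} fls ^ 'd ^ 'd" and W C :: int where
    "g \<in> GL" "mu (lattice_of ` pgl_proj g) = real CARD('k) powi (- int CARD('d))"
    "compactin lattice_space (diag_orbit (lattice_of ` pgl_proj g))"
    "absv (det g) = real CARD('k) powi W" "int N \<le> W" "1 \<in> lattice_of g"
    "\<And>u. u \<in> lattice_of g \<Longrightarrow> u \<noteq> 0 \<Longrightarrow> real CARD('k) powi C \<le> Nprod u"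
proof -
  obtain ix :: "'d \<Rightarrow> nat" where ix: "bij_betw ix UNIV {..<CARD('d)}"
    using ex_bij_betw_finite_nat[of "UNIV :: 'd set"] by (auto simp: atLeast0LessThan)
  \<comment> \<open>The distinct powers keep the nodes apart, and the common factor
    \<open>x ^ N\<close> pushes the edge weights, hence \<open>W\<close>, above
    \<open>N\<close>.\<close>
  define R :: "'d \<Rightarrow> 'k fls" where "R i = fls_X_inv ^ N * fls_X_inv ^ ix i" for i
  have pow: "fls_X_inv ^ k \<in> (poly_ring :: 'k fls set)" for k
    by (induction k) (auto intro: poly_ring_1 poly_ring_mult fls_X_inv_in_poly_ring)
  have R: "R i \<in> poly_ring" for i unfolding R_def by (intro poly_ring_mult pow)
  have inj: "inj R"
  proof (rule injI)
    fix i j assume "R i = R j"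
    then have "fls_subdegree (R i) = fls_subdegree (R j)" by simp
    then have "ix i = ix j" by (simp add: R_def)
    then show "i = j" using ix by (auto simp: bij_betw_def inj_def)
  qed
  obtain \<alpha> where "split_order ix R \<alpha>"
    using ex_split_order[OF d R inj ix] .
  then interpret split_order ix R \<alpha> .
  obtain i j :: 'd where "i \<noteq> j"
    using d by (metis (full_types) UNIV_I card_2_iff' card_le_Suc0_iff_eq finite not_less_eq_eq numeral_2_eq_2)
  have "int N \<le> n i j"
  proof -
    have "fls_X_inv ^ ix i - fls_X_inv ^ ix j \<noteq> (0 :: 'k fls)"
      using inj \<open>i \<noteq> j\<close> by (auto simp: inj_def R_def)
    then have "1 \<le> absv (fls_X_inv ^ ix i - fls_X_inv ^ ix j :: 'k fls)"
      by (intro absv_poly_ring_ge_1 poly_ring_diff pow)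
    then have "real CARD('k) ^ Suc N * 1
        \<le> real CARD('k) ^ Suc N * absv (fls_X_inv ^ ix i - fls_X_inv ^ ix j :: 'k fls)"
      by (intro mult_left_mono) auto
    also have "\<dots> = absv (Q i - Q j)"
      by (simp add: R_def absv_mult absv_power flip: right_diff_distrib)
    finally have "real CARD('k) powi (int (Suc N)) \<le> real CARD('k) powi (n i j)"
      using absv_Q_diff[OF \<open>i \<noteq> j\<close>] by (simp only: power_int_of_nat mult_1_right)
    then show ?thesis using powi_card_le_iff[where 'k='k, of "int (Suc N)"] by simp
  qed
  then have "int N \<le> W" using n_le_W order.trans by blast
  obtain C where "\<And>u. u \<in> lattice_of basis \<Longrightarrow> u \<noteq> 0 \<Longrightarrow> real CARD('k) powi C \<le> Nprod u"
    using Nprod_lattice_bounded_below by blast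
  then show ?thesis
    using that[of basis W C] basis_in_GL mu_basis compactin_orbit absv_det_basis \<open>int N \<le> W\<close>
      one_in_lattice by blast
qed

text \<open>The orbit of \<open>h\<close> contains the class of \<open>h\<close> itself; the
  diagonal matrix and the homothety that relate it to \<open>g\<close> combine into
  \<open>t\<close>.\<close>

lemma diag_orbit_eqD:
  fixes g h :: "'k::{finite,field} fls ^ 'd ^ 'd"
  assumes "g \<in> GL" "h \<in> GL"
    and eq: "diag_orbit (lattice_of ` pgl_proj h) = diag_orbit (lattice_of ` pgl_proj g)"
  obtains t where "\<forall>i. t $ i \<noteq> 0" "lattice_of h = (\<lambda>v. t * v) ` lattice_of g"
    "absv (det h) = Nprod t * absv (det g)"
proof -
  have "diag_mat 1 = (mat 1 :: 'k fls ^ 'd ^ 'd)" by (simp add: mat_eq_diag_mat one_vec_def)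
  then have "lattice_of ` pgl_proj h \<in> diag_orbit (lattice_of ` pgl_proj h)"
    unfolding diag_orbit_lattice_class by (intro image_eqI[of _ _ 1]) auto
  then have "lattice_of ` pgl_proj h
      \<in> (\<lambda>t. lattice_of ` pgl_proj (diag_mat t ** g)) ` {t. \<forall>i. t $ i \<noteq> 0}"
    unfolding eq unfolding diag_orbit_lattice_class .
  then obtain s where "s \<in> {t. \<forall>i. t $ i \<noteq> 0}"
    and s: "lattice_of ` pgl_proj h = lattice_of ` pgl_proj (diag_mat s ** g)"
    by (elim imageE)
  then have s_nz: "\<forall>i. s $ i \<noteq> 0" by simp
  then obtain c where c: "c \<noteq> 0" "lattice_of h = lattice_of (mat c ** (diag_mat s ** g))"
  proof -
    have "lattice_of h \<in> lattice_of ` pgl_proj (diag_mat s ** g)"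
      unfolding s[symmetric] by (intro imageI mem_pgl_proj)
    then show ?thesis using that by (auto simp: pgl_proj_def)
  qed
  let ?t = "(\<chi> i. c) * s"
  have h: "lattice_of h = lattice_of (diag_mat ?t ** g)"
    using c(2) by (simp only: mat_eq_diag_mat matrix_mul_assoc diag_mat_mult_diag_mat)
  have nz: "\<forall>i. ?t $ i \<noteq> 0" using c s_nz by simp
  then have "diag_mat ?t ** g \<in> GL"
    using assms(1) by (intro GL_mult) (simp_all add: diag_mat_in_GL_iff)
  then have "absv (det h) = Nprod ?t * absv (det g)"
    using absv_det_lattice_eq[OF assms(2) _ h] by (simp only: det_mul absv_mult absv_det_diag_mat)
  then show ?thesis by (rule that[OF nz h[unfolded lattice_of_diag_mat_mult]])
qed

text \<open>Write \<open>1 = t * u\<close> with \<open>u\<close> in the lattice of \<open>g\<close>.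
  Then \<open>Nprod t * Nprod u = 1\<close>, so the lower bound for \<open>Nprod u\<close> limits
  the covolume ratio \<open>Nprod t\<close>.\<close>

lemma orbit_det_bound:
  fixes g h :: "'k::{finite,field} fls ^ 'd ^ 'd"
  assumes "g \<in> GL" "h \<in> GL"
    and eq: "diag_orbit (lattice_of ` pgl_proj h) = diag_orbit (lattice_of ` pgl_proj g)"
    and W: "absv (det g) = real CARD('k) powi W" "absv (det h) = real CARD('k) powi W'"
    and one: "1 \<in> lattice_of h"
    and C: "\<And>u. u \<in> lattice_of g \<Longrightarrow> u \<noteq> 0 \<Longrightarrow> real CARD('k) powi C \<le> Nprod u"
  shows "W' \<le> W - C"
proof -
  obtain t where t: "\<forall>i. t $ i \<noteq> 0" "lattice_of h = (\<lambda>v. t * v) ` lattice_of g"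
    "absv (det h) = Nprod t * absv (det g)"
    using diag_orbit_eqD[OF assms(1,2) eq] .
  obtain u where u: "u \<in> lattice_of g" "1 = t * u" using one t(2) by blast
  have "u \<noteq> 0" using u(2) by auto
  then have "real CARD('k) powi C \<le> Nprod u" using C u(1) by blast
  then have "Nprod t * absv (det g) * real CARD('k) powi C \<le> Nprod t * absv (det g) * Nprod u"
    by (intro mult_left_mono) (auto simp: Nprod_nonneg)
  also have "\<dots> = Nprod (t * u) * absv (det g)" by (simp add: Nprod_mult)
  also have "\<dots> = absv (det g)" unfolding u(2)[symmetric] by (simp add: Nprod_def)
  finally have "real CARD('k) powi W' * real CARD('k) powi C \<le> real CARD('k) powi W"
    unfolding W(2)[symmetric] t(3) W(1) .
  then have "real CARD('k) powi (W' + C) \<le> real CARD('k) powi W"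
    by (simp add: power_int_add)
  then show ?thesis using powi_card_le_iff[where 'k='k] by (simp add: le_diff_eq)
qed

theorem theorem1p9:
  fixes q :: nat
  assumes "q = CARD('k::{finite,field})" and "CARD('d::finite) \<ge> 2"
  shows "infinite {orb. \<exists>x \<in> topspace (lattice_space :: ('k fls ^ 'd) set set topology).
           orb = diag_orbit x \<and> compactin lattice_space orb \<and>
           mu x = real q powi (- int CARD('d))}"
proof
  let ?S = "{orb. \<exists>x \<in> topspace (lattice_space :: ('k fls ^ 'd) set set topology).
           orb = diag_orbit x \<and> compactin lattice_space orb \<and>
           mu x = real q powi (- int CARD('d))}"
  assume fin: "finite ?S"
  have "\<exists>(g :: 'k fls ^ 'd ^ 'd) W C. g \<in> GL \<and>
      mu (lattice_of ` pgl_proj g) = real CARD('k) powi (- int CARD('d)) \<and>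
      compactin lattice_space (diag_orbit (lattice_of ` pgl_proj g)) \<and>
      absv (det g) = real CARD('k) powi W \<and> int N \<le> W \<and> 1 \<in> lattice_of g \<and>
      (\<forall>u\<in>lattice_of g. u \<noteq> 0 \<longrightarrow> real CARD('k) powi C \<le> Nprod u)" for N
    by (rule ex_compact_orbit[OF assms(2), where 'k='k and N=N]) blast
  then obtain g :: "nat \<Rightarrow> 'k fls ^ 'd ^ 'd" and W C where
    g: "\<And>N. g N \<in> GL" "\<And>N. mu (lattice_of ` pgl_proj (g N)) = real CARD('k) powi (- int CARD('d))"
      "\<And>N. compactin lattice_space (diag_orbit (lattice_of ` pgl_proj (g N)))"
      "\<And>N. absv (det (g N)) = real CARD('k) powi W N" "\<And>N. int N \<le> W N" "\<And>N. 1 \<in> lattice_of (g N)"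
      "\<And>N u. u \<in> lattice_of (g N) \<Longrightarrow> u \<noteq> 0 \<Longrightarrow> real CARD('k) powi C N \<le> Nprod u"
    by metis
  let ?orb = "\<lambda>N. diag_orbit (lattice_of ` pgl_proj (g N))"
  have "range ?orb \<subseteq> ?S"
    using g(1-3) lattice_class_in_topspace assms(1) by blast
  then have "finite (range ?orb)" using fin by (rule finite_subset)
  \<comment> \<open>Finitely many orbits would force one of them to occur for infinitely many
    indices \<open>M\<close>.\<close>
  then obtain N where N: "infinite {M \<in> UNIV. ?orb M = ?orb N}"
    using pigeonhole_infinite[of UNIV ?orb] by auto
  \<comment> \<open>On that orbit \<open>W M\<close> is bounded by \<open>W N - C N\<close>,
    although \<open>W M\<close> is at least \<open>M\<close>.\<close>
  have "{M \<in> UNIV. ?orb M = ?orb N} \<subseteq> {..nat (W N - C N)}"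
  proof
    fix M assume "M \<in> {M \<in> UNIV. ?orb M = ?orb N}"
    then have "W M \<le> W N - C N"
      using orbit_det_bound[of "g N" "g M" "W N" "W M" "C N"] g by simp
    with g(5)[of M] show "M \<in> {..nat (W N - C N)}" by simp
  qed
  with N show False using finite_subset by blast
qed

end
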